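(* Let $\omega=\sqrt{4\rho-\gamma^2}$. Under the transformation $$y=\int^x\omega(t,\xi)\,d\xi,\quad \tau=t,\quad Q(\tau,y)=\frac1{\omega}\Big(1-\frac{\omega_x}{\omega}\Big),\quad P(\tau,y)=-\frac{\gamma}{\omega},$$ for each integer $n\in\mathbb Z$ the system (dDWW)$_n$ of the dual dispersive water wave hierarchy is related to the system (AdDWW)$_{-(n-1)}$ of the associated dual dispersive water wave hierarchy; that is, if $(\rho(t,x),\gamma(t,x))$ solves (dDWW)$_n$, then the corresponding $(Q(\tau,y),P(\tau,y))$ satisfies (AdDWW)$_{-(n-1)}$.
   Context: Conventions. All operators are formal matrix (pseudo-)differential operators; inverses are formal, and equations involving them are understood up to a suitable choice of integration constants (in particular the possibly time-dependent integration constant in $y=\int^x\omega\,d\xi$). $\partial_x=\omega\partial_y$. dDWW hierarchy. Let $$\mathcal K=\begin{pmatrix}\rho\partial_x+\partial_x\rho&\gamma\partial_x\\ \partial_x\gamma&2\partial_x\end{pmatrix},\qquad \mathcal J=\begin{pmatrix}0&\partial_x-\partial_x^2\\ \partial_x+\partial_x^2&0\end{pmatrix}.$$ (dDWW)$_n$ is $(\rho,\gamma)_t^T=\mathbf M_n$, where for $n\ge1$, $\mathbf M_n=(\mathcal K\mathcal J^{-1})^{n-1}(\rho_x,\gamma_x)^T$; $\mathbf M_0=(0,0)^T$; and for $n\ge1$, $\mathbf M_{-n}=(\mathcal J\mathcal K^{-1})^{n-1}\mathcal J\,\delta\mathcal H_C$, where $\mathcal H_C=-\frac12\int\sqrt{4\rho-\gamma^2}\,dx$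 is a Casimir functional of $\mathcal K$, $\delta\mathcal H_C=\big(-\frac1\omega,\frac{\gamma}{2\omega}\big)^T$. ($\mathbf M_2$ gives the dDWW system $\rho_t=((\rho+v)u)_x$, $\gamma_t=(\gamma u+2v)_x$ with $\rho=v-v_x$, $\gamma=u+u_x$.) AdDWW hierarchy. With $\mathcal X=\partial_y+Q+Q_y\partial_y^{-1}$ and $\mathcal Y=1+P^2+P_y\partial_y^{-1}P$, let $$\overline{\mathcal R}=\begin{pmatrix}\mathcal XP&\mathcal X(Q-\partial_y)\\ \mathcal Y&(P+P_y\partial_y^{-1})(Q-\partial_y)\end{pmatrix}.$$ For $n\ge1$, (AdDWW)$_n$ is $(Q,P)_\tau^T=\overline{\mathcal R}^{\,n-1}(Q_y,P_y)^T$, and (AdDWW)$_{-n}$ is $\overline{\mathcal R}^{\,n}(Q,P)_\tau^T=(0,0)^T$; (AdDWW)$_0$ is the trivial flow $(Q,P)_\tau^T=(0,0)^T$. *)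

theory Defs
  imports "HOL-Analysis.Analysis" "HOL-Library.Function_Algebras"
begin

text \<open>
  Fields are real functions of two real variables, written as functions on pairs: (t, x) for the
  dual hierarchy and (tau, y) for the associated one. Sums and products of fields are pointwise
  (\<^theory>\<open>HOL-Library.Function_Algebras\<close>).
\<close>

type_synonym field2 = "real \<times> real \<Rightarrow> real"
type_synonym vfield2 = "field2 \<times> field2"

definition pd_fst :: "field2 \<Rightarrow> field2" where
  "pd_fst f = (\<lambda>(t, x). deriv (\<lambda>s. f (s, x)) t)"

definition pd_snd :: "field2 \<Rightarrow> field2" where
  "pd_snd f = (\<lambda>(t, x). deriv (\<lambda>s. f (t, s)) x)"

primrec Ck_on :: "nat \<Rightarrow> (real \<times> real) set \<Rightarrow> field2 \<Rightarrow> bool" where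
  "Ck_on 0 D f \<longleftrightarrow> continuous_on D f"
| "Ck_on (Suc k) D f \<longleftrightarrow> f differentiable_on D \<and> Ck_on k D (pd_fst f) \<and> Ck_on k D (pd_snd f)"

text \<open>Intended for open \<open>D\<close> only; then \<open>f\<close> may be arbitrary outside \<open>D\<close>.\<close>

definition smooth_on :: "(real \<times> real) set \<Rightarrow> field2 \<Rightarrow> bool" where
  "smooth_on D f \<longleftrightarrow> (\<forall>k. Ck_on k D f)"

definition vsmooth_on :: "(real \<times> real) set \<Rightarrow> vfield2 \<Rightarrow> bool" where
  "vsmooth_on D u \<longleftrightarrow> smooth_on D (fst u) \<and> smooth_on D (snd u)"

definition veq_on :: "(real \<times> real) set \<Rightarrow> vfield2 \<Rightarrow> vfield2 \<Rightarrow> bool" where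
  "veq_on D u v \<longleftrightarrow> (\<forall>z\<in>D. fst u z = fst v z \<and> snd u z = snd v z)"

definition K_op :: "field2 \<Rightarrow> field2 \<Rightarrow> vfield2 \<Rightarrow> vfield2" where
  "K_op \<rho> \<gamma> = (\<lambda>(a, b).
     (\<rho> * pd_snd a + pd_snd (\<rho> * a) + \<gamma> * pd_snd b,
      pd_snd (\<gamma> * a) + 2 * pd_snd b))"

definition J_op :: "vfield2 \<Rightarrow> vfield2" where
  "J_op = (\<lambda>(a, b).
     (pd_snd b - pd_snd (pd_snd b), pd_snd a + pd_snd (pd_snd a)))"

text \<open>
  Formal operators are represented by their graphs on smooth fields, so that the formal inverse is
  the converse relation and composition is relational composition: \<open>u\<close> is related to \<open>v\<close> by the
  graph of an operator word if \<open>v\<close> is a value of the word at \<open>u\<close> for some choice of the integration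
  constants (which may depend on the first variable) made each time an inverse is applied.
  As \<open>O\<close> composes from left to right, \<open>K J\<^sup>-\<^sup>1\<close> has graph \<open>J\<inverse> O K\<close>.
\<close>

definition graph_on ::
  "(real \<times> real) set \<Rightarrow> (vfield2 \<Rightarrow> vfield2) \<Rightarrow> (vfield2 \<times> vfield2) set" where
  "graph_on D A = {(u, v). vsmooth_on D u \<and> vsmooth_on D v \<and> veq_on D v (A u)}"

definition omega :: "field2 \<Rightarrow> field2 \<Rightarrow> field2" where
  "omega \<rho> \<gamma> = (\<lambda>z. sqrt (4 * \<rho> z - (\<gamma> z)\<^sup>2))"

definition casimir_density :: "real \<Rightarrow> real \<Rightarrow> real" where
  "casimir_density r g = - (1 / 2) * sqrt (4 * r - g\<^sup>2)"

text \<open>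
  The variational derivative of the Casimir functional. The density contains no derivatives of the
  fields, so this is its gradient, see \<open>casimir_grad_eq\<close> below.
\<close>

definition casimir_grad :: "field2 \<Rightarrow> field2 \<Rightarrow> vfield2" where
  "casimir_grad \<rho> \<gamma> =
     ((\<lambda>z. - 1 / omega \<rho> \<gamma> z), (\<lambda>z. \<gamma> z / (2 * omega \<rho> \<gamma> z)))"

lemma casimir_grad_eq:
  assumes "4 * \<rho> z - (\<gamma> z)\<^sup>2 > 0"
  shows "((\<lambda>r. casimir_density r (\<gamma> z)) has_real_derivative fst (casimir_grad \<rho> \<gamma>) z) (at (\<rho> z))"
    and "((\<lambda>g. casimir_density (\<rho> z) g) has_real_derivative snd (casimir_grad \<rho> \<gamma>) z) (at (\<gamma> z))"
  unfolding casimir_density_def casimir_grad_def omega_def using assms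
  by (auto intro!: derivative_eq_intros simp: field_simps)

text \<open>The admissible values of the right-hand side \<open>M\<^sub>n\<close>, over all integration constants.\<close>

definition dDWW_flux ::
  "(real \<times> real) set \<Rightarrow> field2 \<Rightarrow> field2 \<Rightarrow> int \<Rightarrow> vfield2 set" where
  "dDWW_flux D \<rho> \<gamma> n =
     (let K = graph_on D (K_op \<rho> \<gamma>); J = graph_on D J_op in
      if n \<ge> 1 then ((J\<inverse> O K) ^^ nat (n - 1)) `` {(pd_snd \<rho>, pd_snd \<gamma>)}
      else if n = 0 then {(0, 0)}
      else ((K\<inverse> O J) ^^ nat (- n - 1)) `` {J_op (casimir_grad \<rho> \<gamma>)})"

definition solves_dDWW ::
  "(real \<times> real) set \<Rightarrow> int \<Rightarrow> field2 \<Rightarrow> field2 \<Rightarrow> bool" where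
  "solves_dDWW D n \<rho> \<gamma> \<longleftrightarrow>
     smooth_on D \<rho> \<and> smooth_on D \<gamma> \<and>
     (\<exists>M \<in> dDWW_flux D \<rho> \<gamma> n. veq_on D (pd_fst \<rho>, pd_fst \<gamma>) M)"

text \<open>In the next two definitions \<open>F\<close> stands for the chosen value of \<open>\<partial>\<^sub>y\<inverse> f\<close> and of
  \<open>\<partial>\<^sub>y\<inverse> (P f)\<close>, respectively.\<close>

definition X_op :: "field2 \<Rightarrow> field2 \<Rightarrow> field2 \<Rightarrow> field2" where
  "X_op Q f F = pd_snd f + Q * f + pd_snd Q * F"

definition Y_op :: "field2 \<Rightarrow> field2 \<Rightarrow> field2 \<Rightarrow> field2" where
  "Y_op P f F = f + P * P * f + pd_snd P * F"

text \<open>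
  Applied to \<open>(q, p)\<close>, the operator integrates two expressions: \<open>f = P q\<close> (first column, in both
  rows) and \<open>g = (Q - \<partial>\<^sub>y) p\<close> (second column, in both rows). Their antiderivatives
  \<open>F\<close> and \<open>G\<close> are chosen once per application and shared by the two rows.
\<close>

definition Rbar_graph ::
  "(real \<times> real) set \<Rightarrow> field2 \<Rightarrow> field2 \<Rightarrow> (vfield2 \<times> vfield2) set" where
  "Rbar_graph D Q P = {(u, v). vsmooth_on D u \<and> vsmooth_on D v \<and>
     (\<exists>F G. let (q, p) = u; f = P * q; g = Q * p - pd_snd p in
        smooth_on D F \<and> smooth_on D G \<and>
        (\<forall>z\<in>D. pd_snd F z = f z \<and> pd_snd G z = g z) \<and>
        veq_on D v
          (X_op Q f F + X_op Q g G,
           Y_op P q F + (P * g + pd_snd P * G)))}"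

definition solves_AdDWW ::
  "(real \<times> real) set \<Rightarrow> int \<Rightarrow> field2 \<Rightarrow> field2 \<Rightarrow> bool" where
  "solves_AdDWW D m Q P \<longleftrightarrow>
     smooth_on D Q \<and> smooth_on D P \<and>
     (let R = Rbar_graph D Q P; flow = (pd_fst Q, pd_fst P) in
      if m \<ge> 1 then
        (\<exists>N \<in> (R ^^ nat (m - 1)) `` {(pd_snd Q, pd_snd P)}. veq_on D flow N)
      else if m = 0 then veq_on D flow (0, 0)
      else (\<exists>N \<in> (R ^^ nat (- m)) `` {flow}. veq_on D N (0, 0)))"

text \<open>
  On a domain whose slices of constant \<open>t\<close> are intervals, \<open>y\<^sub>x = \<omega>\<close> says that \<open>y\<close> is
  \<open>\<integral>\<^sup>x \<omega> d\<xi>\<close> for some choice of the integration constant, possibly depending on \<open>t\<close>.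
\<close>

definition new_domain :: "(real \<times> real) set \<Rightarrow> field2 \<Rightarrow> (real \<times> real) set" where
  "new_domain D y = (\<lambda>(t, x). (t, y (t, x))) ` D"

definition transformed ::
  "(real \<times> real) set \<Rightarrow> field2 \<Rightarrow> field2 \<Rightarrow> field2 \<Rightarrow> field2 \<Rightarrow> field2 \<Rightarrow> bool" where
  "transformed D \<rho> \<gamma> y Q P \<longleftrightarrow>
     smooth_on D y \<and>
     (let \<omega> = omega \<rho> \<gamma> in
      \<forall>(t, x)\<in>D.
        pd_snd y (t, x) = \<omega> (t, x) \<and>
        Q (t, y (t, x)) = 1 / \<omega> (t, x) * (1 - pd_snd \<omega> (t, x) / \<omega> (t, x)) \<and>
        P (t, y (t, x)) = - \<gamma> (t, x) / \<omega> (t, x))"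

end

theory Submission
  imports Defs
begin

text \<open>
  If \<open>(\<rho>, \<gamma>)\<^sub>t = K (a, b)\<close> then \<open>\<omega>\<^sub>t = (\<omega> a)\<^sub>x\<close>, so \<open>y\<close> can be chosen with \<open>y\<^sub>x = \<omega>\<close> and
  \<open>y\<^sub>t = \<omega> a\<close>, and then \<open>Q\<^sub>\<tau> = -(a + a\<^sub>x)\<^sub>y\<close> and \<open>P\<^sub>\<tau> = -2 b\<^sub>y\<close>. If in addition
  \<open>K (a', b') = J (a, b)\<close>, then the recursion operator of the associated hierarchy sends
  \<open>(-(a + a\<^sub>x)\<^sub>y, -2 b\<^sub>y)\<close> to \<open>(-(a' + a'\<^sub>x)\<^sub>y, -2 b'\<^sub>y)\<close>, where the two antiderivatives it
  uses add up to \<open>-\<omega> a'\<close>. So a chain of such pairs on the dual side becomes an orbit of the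
  recursion operator. The chains end at \<open>(1, 0)\<close>, with \<open>K (1, 0) = (\<rho>\<^sub>x, \<gamma>\<^sub>x)\<close>, which corresponds
  to \<open>(0, 0)\<close>, or start at the Casimir gradient, which corresponds to \<open>(Q\<^sub>y, P\<^sub>y)\<close>.
\<close>


subsection \<open>Smooth fields of two variables\<close>

text \<open>\<open>pd_fst\<close> and \<open>pd_snd\<close> are one-variable derivatives along
  coordinate lines. Restricting the total derivative to these lines identifies its two coefficients,
  and linearity gives the rest.\<close>

lemma has_derivative_pd:
  assumes "f differentiable (at z)"
  shows "(f has_derivative (\<lambda>h. pd_fst f z * fst h + pd_snd f z * snd h)) (at z)"
proof -
  obtain f' where f': "(f has_derivative f') (at z)"
    using assms by (auto simp: differentiable_def)
  then have lin: "linear f'"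
    by (rule has_derivative_linear)
  obtain t x where z: "z = (t, x)" by (cases z)
  have "((\<lambda>s. f (s, x)) has_derivative (\<lambda>h. f' (h, 0))) (at t)"
    by (rule has_derivative_eq_rhs[OF has_derivative_compose[of "\<lambda>s. (s, x)", OF _ f'[unfolded z]]])
      (auto intro!: derivative_eq_intros)
  moreover have f1: "f' (h, 0) = f' (1, 0) * h" for h
    using linear_cmul[OF lin, of h "(1, 0)"] by simp
  then have "(\<lambda>h. f' (h, 0)) = (*) (f' (1, 0))"
    by (rule ext)
  ultimately have 1: "pd_fst f z = f' (1, 0)"
    by (simp only: pd_fst_def z prod.case DERIV_imp_deriv has_field_derivative_def)
  have "((\<lambda>s. f (t, s)) has_derivative (\<lambda>h. f' (0, h))) (at x)"
    by (rule has_derivative_eq_rhs[OF has_derivative_compose[of "\<lambda>s. (t, s)", OF _ f'[unfolded z]]])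
      (auto intro!: derivative_eq_intros)
  moreover have f2: "f' (0, h) = f' (0, 1) * h" for h
    using linear_cmul[OF lin, of h "(0, 1)"] by simp
  then have "(\<lambda>h. f' (0, h)) = (*) (f' (0, 1))"
    by (rule ext)
  ultimately have 2: "pd_snd f z = f' (0, 1)"
    by (simp only: pd_snd_def z prod.case DERIV_imp_deriv has_field_derivative_def)
  have "f' h = pd_fst f z * fst h + pd_snd f z * snd h" for h
    using linear_add[OF lin, of "(fst h, 0)" "(0, snd h)"] f1[of "fst h"] f2[of "snd h"]
    unfolding 1 2 by simp
  then have "f' = (\<lambda>h. pd_fst f z * fst h + pd_snd f z * snd h)"
    by (rule ext)
  with f' show ?thesis by simp
qed

lemma has_derivative_pd_unique:
  assumes "(f has_derivative (\<lambda>h. a * fst h + b * snd h)) (at z)"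
  shows "pd_fst f z = a" "pd_snd f z = b"
proof -
  have "f differentiable (at z)"
    using assms by (auto simp: differentiable_def)
  from has_derivative_unique[OF has_derivative_pd[OF this] assms]
  have "pd_fst f z * fst h + pd_snd f z * snd h = a * fst h + b * snd h" for h
    by (rule fun_cong)
  from this[of "(1, 0)"] this[of "(0, 1)"] show "pd_fst f z = a" "pd_snd f z = b"
    by simp_all
qed

text \<open>Fields are arbitrary outside \<open>D\<close>, so identities are available on
  \<open>D\<close> only. Openness is what allows them to be differentiated.\<close>

lemma pd_cong:
  assumes "open D" "z \<in> D" "\<And>z. z \<in> D \<Longrightarrow> f z = g z"
  shows "pd_fst f z = pd_fst g z" "pd_snd f z = pd_snd g z"
proof -
  obtain t x where z: "z = (t, x)" by (cases z)
  have "\<forall>\<^sub>F w in nhds (t, x). f w = g w"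
    using assms z eventually_nhds by blast
  moreover have "filterlim (\<lambda>s. (s, x)) (nhds (t, x)) (nhds t)"
    "filterlim (\<lambda>s. (t, s)) (nhds (t, x)) (nhds x)"
    by (auto intro!: tendsto_Pair filterlim_ident)
  ultimately have "\<forall>\<^sub>F s in nhds t. f (s, x) = g (s, x)" "\<forall>\<^sub>F s in nhds x. f (t, s) = g (t, s)"
    by (auto dest: eventually_compose_filterlim)
  then show "pd_fst f z = pd_fst g z" "pd_snd f z = pd_snd g z"
    by (auto simp: pd_fst_def pd_snd_def z intro: deriv_cong_ev)
qed

lemma Ck_on_cong:
  assumes "open D" "Ck_on k D f" "\<And>z. z \<in> D \<Longrightarrow> f z = g z"
  shows "Ck_on k D g"
  using assms(2,3)
proof (induction k arbitrary: f g)
  case 0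
  then show ?case
    by (simp cong: continuous_on_cong)
next
  case (Suc k)
  have "g differentiable_on D"
    using Suc.prems has_derivative_transform[of _ D g f]
    by (auto simp: differentiable_on_def differentiable_def) (metis)
  moreover have "Ck_on k D (pd_fst g)" "Ck_on k D (pd_snd g)"
    using Suc.prems Suc.IH[OF _ pd_cong(1)[OF assms(1), of _ f g]]
      Suc.IH[OF _ pd_cong(2)[OF assms(1), of _ f g]] by auto
  ultimately show ?case by simp
qed

lemma smooth_on_cong:
  assumes "open D" "smooth_on D f" "\<And>z. z \<in> D \<Longrightarrow> f z = g z"
  shows "smooth_on D g"
  using assms Ck_on_cong unfolding smooth_on_def by blast

text \<open>If both partial derivatives of each member of \<open>S\<close> agree on \<open>D\<close>
  with members of \<open>S\<close>, the order of differentiability of all members rises together by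
  induction on \<open>k\<close>. Smoothness of a whole family is thus reduced to a single
  differentiation.\<close>

lemma smooth_on_coinduct:
  assumes "open D" and "f \<in> S"
    and step: "\<And>f. f \<in> S \<Longrightarrow> \<exists>a\<in>S. \<exists>b\<in>S. \<forall>z\<in>D.
      (f has_derivative (\<lambda>h. a z * fst h + b z * snd h)) (at z)"
  shows "smooth_on D f"
proof -
  have "Ck_on k D f" if "f \<in> S" for k f
    using that
  proof (induction k arbitrary: f)
    case 0
    then obtain a b where "\<And>z. z \<in> D \<Longrightarrow> (f has_derivative (\<lambda>h. a z * fst h + b z * snd h)) (at z)"
      using step by blast
    then have "isCont f z" if "z \<in> D" for z
      using that has_derivative_continuous by blast
    then show ?case
      by (simp add: continuous_at_imp_continuous_on)
  next
    case (Suc k)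
    from step[OF this(2)] obtain a b where ab: "a \<in> S" "b \<in> S"
      and d: "\<And>z. z \<in> D \<Longrightarrow> (f has_derivative (\<lambda>h. a z * fst h + b z * snd h)) (at z)"
      by blast
    have "f differentiable_on D"
      using d by (auto simp: differentiable_on_def differentiable_def intro: has_derivative_at_withinI)
    moreover have "Ck_on k D (pd_fst f)" "Ck_on k D (pd_snd f)"
      using Ck_on_cong[OF assms(1) Suc.IH[OF ab(1)]] Ck_on_cong[OF assms(1) Suc.IH[OF ab(2)]]
        has_derivative_pd_unique[OF d] by auto
    ultimately show ?case by simp
  qed
  with assms(2) show ?thesis by (simp add: smooth_on_def)
qed

lemma smooth_on_differentiable: "smooth_on D f \<Longrightarrow> f differentiable_on D"
  by (metis smooth_on_def Ck_on.simps(2))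

lemma smooth_on_pd:
  assumes "smooth_on D f"
  shows "smooth_on D (pd_fst f)" "smooth_on D (pd_snd f)"
  using assms by (metis smooth_on_def Ck_on.simps(2))+

lemma smooth_on_has_derivative:
  assumes "open D" "smooth_on D f" "z \<in> D"
  shows "(f has_derivative (\<lambda>h. pd_fst f z * fst h + pd_snd f z * snd h)) (at z)"
  using assms by (intro has_derivative_pd)
    (auto dest: smooth_on_differentiable simp: differentiable_on_eq_differentiable_at)

lemma smooth_on_continuous: "smooth_on D f \<Longrightarrow> continuous_on D f"
  by (metis smooth_on_def Ck_on.simps(1))

lemma DERIV_slice:
  assumes "(f has_derivative (\<lambda>h. a * fst h + b * snd h)) (at (t, x))"
  shows "((\<lambda>s. f (s, x)) has_real_derivative a) (at t)"
    "((\<lambda>s. f (t, s)) has_real_derivative b) (at x)"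
proof -
  have "((\<lambda>s. f (s, x)) has_derivative (\<lambda>h. a * h)) (at t)"
    by (rule has_derivative_eq_rhs[OF has_derivative_compose[of "\<lambda>s. (s, x)", OF _ assms]])
      (auto intro!: derivative_eq_intros)
  then show "((\<lambda>s. f (s, x)) has_real_derivative a) (at t)"
    by (simp add: has_field_derivative_def)
  have "((\<lambda>s. f (t, s)) has_derivative (\<lambda>h. b * h)) (at x)"
    by (rule has_derivative_eq_rhs[OF has_derivative_compose[of "\<lambda>s. (t, s)", OF _ assms]])
      (auto intro!: derivative_eq_intros)
  then show "((\<lambda>s. f (t, s)) has_real_derivative b) (at x)"
    by (simp add: has_field_derivative_def)
qed

lemma DERIV_pd:
  assumes "open D" "smooth_on D f" "(t, x) \<in> D"
  shows "((\<lambda>s. f (s, x)) has_real_derivative pd_fst f (t, x)) (at t)"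
    "((\<lambda>s. f (t, s)) has_real_derivative pd_snd f (t, x)) (at x)"
  by (rule DERIV_slice[OF smooth_on_has_derivative[OF assms]])+

lemma pd_eqI:
  shows "((\<lambda>s. f (s, x)) has_real_derivative a) (at t) \<Longrightarrow> pd_fst f (t, x) = a"
    and "((\<lambda>s. f (t, s)) has_real_derivative b) (at x) \<Longrightarrow> pd_snd f (t, x) = b"
  by (simp_all add: pd_fst_def pd_snd_def DERIV_imp_deriv)

section \<open>Smoothness of sums, products, inverses and square roots\<close>

inductive_set smooth_closure :: "(real \<times> real) set \<Rightarrow> field2 set" for D where
  base: "smooth_on D f \<Longrightarrow> f \<in> smooth_closure D"
| const: "(\<lambda>_. c) \<in> smooth_closure D"
| add: "f \<in> smooth_closure D \<Longrightarrow> g \<in> smooth_closure D \<Longrightarrow> (\<lambda>z. f z + g z) \<in> smooth_closure D"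
| mult: "f \<in> smooth_closure D \<Longrightarrow> g \<in> smooth_closure D \<Longrightarrow> (\<lambda>z. f z * g z) \<in> smooth_closure D"
| inv: "f \<in> smooth_closure D \<Longrightarrow> (\<And>z. z \<in> D \<Longrightarrow> f z \<noteq> 0) \<Longrightarrow> (\<lambda>z. inverse (f z)) \<in> smooth_closure D"
| sqroot: "f \<in> smooth_closure D \<Longrightarrow> (\<And>z. z \<in> D \<Longrightarrow> f z > 0) \<Longrightarrow> (\<lambda>z. sqrt (f z)) \<in> smooth_closure D"

text \<open>The operations are treated jointly because differentiating one produces others: an
  inverse yields products, a square root yields inverses. The derivative of each constructor is
  again built from constructors, so coinduction applies.\<close>

lemma smooth_closure_smooth_on:
  assumes "open D" "f \<in> smooth_closure D"
  shows "smooth_on D f"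
  using assms
proof (rule smooth_on_coinduct)
  fix f assume "f \<in> smooth_closure D"
  then show "\<exists>a\<in>smooth_closure D. \<exists>b\<in>smooth_closure D. \<forall>z\<in>D.
      (f has_derivative (\<lambda>h. a z * fst h + b z * snd h)) (at z)"
  proof induction
    case (base f)
    then show ?case
      using smooth_on_pd smooth_on_has_derivative[OF assms(1)] smooth_closure.base by blast
  next
    case (const c)
    have "((\<lambda>_. c) has_derivative (\<lambda>h. 0 * fst h + 0 * snd h)) (at z)" for z :: "real \<times> real"
      by simp
    then show ?case
      using smooth_closure.const[of 0 D] by (intro bexI[of _ "\<lambda>_. 0"]) auto
  next
    case (add f g)
    then obtain a b c d where m: "a \<in> smooth_closure D" "b \<in> smooth_closure D"
      "c \<in> smooth_closure D" "d \<in> smooth_closure D"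
      and df: "\<And>z. z \<in> D \<Longrightarrow> (f has_derivative (\<lambda>h. a z * fst h + b z * snd h)) (at z)"
      and dg: "\<And>z. z \<in> D \<Longrightarrow> (g has_derivative (\<lambda>h. c z * fst h + d z * snd h)) (at z)"
      by blast
    have "((\<lambda>z. f z + g z) has_derivative (\<lambda>h. (a z + c z) * fst h + (b z + d z) * snd h)) (at z)"
      if "z \<in> D" for z
      by (rule has_derivative_eq_rhs[OF has_derivative_add[OF df[OF that] dg[OF that]]])
        (simp add: algebra_simps)
    then show ?case
      using smooth_closure.add[OF m(1,3)] smooth_closure.add[OF m(2,4)]
      by (intro bexI[of _ "\<lambda>z. a z + c z"] bexI[of _ "\<lambda>z. b z + d z"]) auto
  next
    case (mult f g)
    then obtain a b c d where m: "a \<in> smooth_closure D" "b \<in> smooth_closure D"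
      "c \<in> smooth_closure D" "d \<in> smooth_closure D"
      and df: "\<And>z. z \<in> D \<Longrightarrow> (f has_derivative (\<lambda>h. a z * fst h + b z * snd h)) (at z)"
      and dg: "\<And>z. z \<in> D \<Longrightarrow> (g has_derivative (\<lambda>h. c z * fst h + d z * snd h)) (at z)"
      by blast
    have "((\<lambda>z. f z * g z) has_derivative
        (\<lambda>h. (a z * g z + f z * c z) * fst h + (b z * g z + f z * d z) * snd h)) (at z)"
      if "z \<in> D" for z
      by (rule has_derivative_eq_rhs[OF has_derivative_mult[OF df[OF that] dg[OF that]]])
        (simp add: algebra_simps)
    then show ?case
      using mult.hyps m
      by (intro bexI[of _ "\<lambda>z. a z * g z + f z * c z"] bexI[of _ "\<lambda>z. b z * g z + f z * d z"])
        (auto intro: smooth_closure.intros)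
  next
    case (inv f)
    then obtain a b where m: "a \<in> smooth_closure D" "b \<in> smooth_closure D"
      and df: "\<And>z. z \<in> D \<Longrightarrow> (f has_derivative (\<lambda>h. a z * fst h + b z * snd h)) (at z)"
      by blast
    \<comment> \<open>Both coefficients are written with constants, products and inverses only, so
      that their membership in the closure follows from the introduction rules.\<close>
    have *: "((\<lambda>z. inverse (f z)) has_derivative
        (\<lambda>h. (- 1 * (a z * (inverse (f z) * inverse (f z)))) * fst h
             + (- 1 * (b z * (inverse (f z) * inverse (f z)))) * snd h)) (at z)"
      if "z \<in> D" for z
      by (rule has_derivative_eq_rhs[OF Deriv.has_derivative_inverse[OF inv(2)[OF that] df[OF that]]])
        (simp add: algebra_simps)
    then show ?case
      using inv.hyps m
      by (intro bexI[of _ "\<lambda>z. - 1 * (a z * (inverse (f z) * inverse (f z)))"]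
            bexI[of _ "\<lambda>z. - 1 * (b z * (inverse (f z) * inverse (f z)))"] ballI)
        (assumption | rule * smooth_closure.mult smooth_closure.inv smooth_closure.const)+
  next
    case (sqroot f)
    then obtain a b where m: "a \<in> smooth_closure D" "b \<in> smooth_closure D"
      and df: "\<And>z. z \<in> D \<Longrightarrow> (f has_derivative (\<lambda>h. a z * fst h + b z * snd h)) (at z)"
      by blast
    have *: "((\<lambda>z. sqrt (f z)) has_derivative
        (\<lambda>h. (1 / 2 * (a z * inverse (sqrt (f z)))) * fst h
             + (1 / 2 * (b z * inverse (sqrt (f z)))) * snd h)) (at z)"
      if "z \<in> D" for z
      by (rule has_derivative_eq_rhs[OF has_derivative_real_sqrt[OF sqroot(2)[OF that] df[OF that]]])
        (simp add: field_simps add_divide_distrib)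
    have "f z \<noteq> 0" if "z \<in> D" for z
      using sqroot.hyps(2)[OF that] by simp
    then have i: "(\<lambda>z. inverse (sqrt (f z))) \<in> smooth_closure D"
      using smooth_closure.inv[OF smooth_closure.sqroot[OF sqroot.hyps]] by simp
    show ?case
      by (rule bexI[OF _ smooth_closure.mult[OF smooth_closure.const smooth_closure.mult[OF m(1) i], of "1 / 2"]],
          rule bexI[OF _ smooth_closure.mult[OF smooth_closure.const smooth_closure.mult[OF m(2) i], of "1 / 2"]])
        (rule ballI, rule *)
  qed
qed

lemma smooth_on_const: "open D \<Longrightarrow> smooth_on D (\<lambda>_. c)"
  by (rule smooth_closure_smooth_on, assumption, intro smooth_closure.intros)

lemma smooth_on_add:
  "open D \<Longrightarrow> smooth_on D f \<Longrightarrow> smooth_on D g \<Longrightarrow> smooth_on D (\<lambda>z. f z + g z)"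
  by (rule smooth_closure_smooth_on, assumption, intro smooth_closure.intros)

lemma smooth_on_mult:
  "open D \<Longrightarrow> smooth_on D f \<Longrightarrow> smooth_on D g \<Longrightarrow> smooth_on D (\<lambda>z. f z * g z)"
  by (rule smooth_closure_smooth_on, assumption, intro smooth_closure.intros)

lemma smooth_on_minus: "open D \<Longrightarrow> smooth_on D f \<Longrightarrow> smooth_on D (\<lambda>z. - f z)"
  using smooth_on_mult[OF _ smooth_on_const, of D f "- 1"] by simp

lemma smooth_on_diff:
  "open D \<Longrightarrow> smooth_on D f \<Longrightarrow> smooth_on D g \<Longrightarrow> smooth_on D (\<lambda>z. f z - g z)"
  using smooth_on_add[OF _ _ smooth_on_minus, of D f g] by simp

lemma smooth_on_divide:
  "open D \<Longrightarrow> smooth_on D f \<Longrightarrow> smooth_on D g \<Longrightarrow> (\<And>z. z \<in> D \<Longrightarrow> g z \<noteq> 0) \<Longrightarrow>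
    smooth_on D (\<lambda>z. f z / g z)"
  unfolding divide_inverse by (rule smooth_closure_smooth_on, assumption, intro smooth_closure.intros)

lemma smooth_on_sqrt:
  "open D \<Longrightarrow> smooth_on D f \<Longrightarrow> (\<And>z. z \<in> D \<Longrightarrow> f z > 0) \<Longrightarrow> smooth_on D (\<lambda>z. sqrt (f z))"
  by (rule smooth_closure_smooth_on, assumption, intro smooth_closure.intros)

lemma smooth_on_power: "open D \<Longrightarrow> smooth_on D f \<Longrightarrow> smooth_on D (\<lambda>z. f z ^ n)"
  by (induction n) (auto intro: smooth_on_const smooth_on_mult)

lemmas smooth_intros = smooth_on_const smooth_on_add smooth_on_mult smooth_on_minus
  smooth_on_diff smooth_on_divide smooth_on_sqrt smooth_on_power smooth_on_pd

subsection \<open>Antiderivatives and potentials on a rectangle\<close>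

text \<open>Antiderivatives in \<open>x\<close> start at \<open>x0\<close>, potentials at
  \<open>(t0, x0)\<close>. A product of intervals contains the coordinate paths from this base point
  to any other point.\<close>

locale strip =
  fixes T X :: "real set" and t0 x0 :: real
  assumes open_T: "open T" and int_T: "is_interval T" and t0: "t0 \<in> T"
    and open_X: "open X" and int_X: "is_interval X" and x0: "x0 \<in> X"
begin

definition D where "D = T \<times> X"

lemma open_D: "open D"
  unfolding D_def using open_T open_X by (rule open_Times)

lemma convex_D: "convex D"
  unfolding D_def using int_T int_X by (simp add: convex_Times is_interval_convex)

lemma mem_D: "(t, x) \<in> D \<longleftrightarrow> t \<in> T \<and> x \<in> X"
  by (simp add: D_def)

lemma scaled_mem:
  assumes "is_interval I" "a \<in> I" "b \<in> I" "c \<in> {0..1::real}"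
  shows "a + c * (b - a) \<in> I"
proof -
  have "(1 - c) *\<^sub>R a + c *\<^sub>R b \<in> I"
    using assms by (intro convexD_alt is_interval_convex) auto
  then show ?thesis by (simp add: algebra_simps)
qed

section \<open>Integrals along scaled segments\<close>

definition scaled_point :: "(real \<Rightarrow> real) \<Rightarrow> (real \<Rightarrow> real) \<Rightarrow> real \<times> real \<Rightarrow> real \<Rightarrow> real \<times> real" where
  "scaled_point k l z s = (t0 + k s * (fst z - t0), x0 + l s * (snd z - x0))"

text \<open>The factor \<open>h\<close> makes the family closed under differentiation: a
  \<open>t\<close>-derivative turns \<open>h\<close> into \<open>h * k\<close>, an
  \<open>x\<close>-derivative into \<open>h * l\<close>. The weights \<open>s\<close>,
  \<open>1\<close> and \<open>0\<close> let a coordinate run along the segment, keep it, or freeze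
  it at the base point.\<close>

definition scaled_integral :: "(real \<Rightarrow> real) \<Rightarrow> (real \<Rightarrow> real) \<Rightarrow> (real \<Rightarrow> real) \<Rightarrow> field2 \<Rightarrow> field2" where
  "scaled_integral h k l f z = integral {0..1} (\<lambda>s. h s * f (scaled_point k l z s))"

definition weight :: "(real \<Rightarrow> real) \<Rightarrow> bool" where
  "weight k \<longleftrightarrow> continuous_on {0..1} k \<and> k ` {0..1} \<subseteq> {0..1}"

lemma scaled_point_mem:
  assumes "weight k" "weight l" "z \<in> D" "s \<in> {0..1}"
  shows "scaled_point k l z s \<in> D"
proof -
  have "k s \<in> {0..1}" "l s \<in> {0..1}"
    using assms unfolding weight_def by blast+
  then show ?thesis
    using assms scaled_mem[OF int_T t0] scaled_mem[OF int_X x0]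
    by (cases z) (simp add: scaled_point_def mem_D)
qed

lemma continuous_on_scaled:
  assumes "weight k" "weight l" "continuous_on D f"
  shows "continuous_on (D \<times> {0..1}) (\<lambda>(z, s). f (scaled_point k l z s))"
proof -
  have k: "continuous_on (D \<times> {0..1}) (\<lambda>p. k (snd p))" and l: "continuous_on (D \<times> {0..1}) (\<lambda>p. l (snd p))"
    using assms unfolding weight_def
    by (auto intro!: continuous_on_compose2[of "{0..1}" k] continuous_on_compose2[of "{0..1}" l]
        continuous_intros)
  have "continuous_on (D \<times> {0..1}) (\<lambda>p. scaled_point k l (fst p) (snd p))"
    unfolding scaled_point_def by (intro continuous_intros k l)
  then have "continuous_on (D \<times> {0..1}) (\<lambda>p. f (scaled_point k l (fst p) (snd p)))"
    by (rule continuous_on_compose2[OF assms(3)]) (use assms scaled_point_mem in auto)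
  then show ?thesis by (simp add: case_prod_unfold)
qed

lemma scaled_integrable:
  fixes f :: field2 and h :: "real \<Rightarrow> real"
  assumes "weight k" "weight l" "continuous_on {0..1} h" "continuous_on D f" "z \<in> D"
  shows "continuous_on {0..1} (\<lambda>s. h s * f (scaled_point k l z s))"
    and "(\<lambda>s. h s * f (scaled_point k l z s)) integrable_on {0..1}"
proof -
  have "continuous_on {0..1} (\<lambda>s. f (scaled_point k l z s))"
    using continuous_on_compose2[OF continuous_on_scaled[OF assms(1,2,4)], of "{0..1}" "\<lambda>s. (z, s)"]
      assms(5) by (force intro!: continuous_intros)
  then show "continuous_on {0..1} (\<lambda>s. h s * f (scaled_point k l z s))"
    using assms by (auto intro: continuous_on_mult)
  then show "(\<lambda>s. h s * f (scaled_point k l z s)) integrable_on {0..1}"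
    by (rule integrable_continuous_real)
qed

lemma scaled_integral_has_derivative:
  assumes k: "weight k" and l: "weight l" and h: "continuous_on {0..1} h" and f: "smooth_on D f"
    and z: "z \<in> D"
  shows "(scaled_integral h k l f has_derivative
    (\<lambda>d. scaled_integral (\<lambda>s. h s * k s) k l (pd_fst f) z * fst d
       + scaled_integral (\<lambda>s. h s * l s) k l (pd_snd f) z * snd d)) (at z)"
proof -
  define A where "A w s = (h s * k s) * pd_fst f (scaled_point k l w s)" for w s
  define B where "B w s = (h s * l s) * pd_snd f (scaled_point k l w s)" for w s
  \<comment> \<open>The Leibniz rule wants the derivative as a bounded linear map depending
    continuously on the point and on \<open>s\<close>. Written over the two projections, its
    integral splits into those of \<open>A\<close> and \<open>B\<close>.\<close>
  define fx where "fx w s = A w s *\<^sub>R (fst_blinfun :: (real \<times> real) \<Rightarrow>\<^sub>L real) + B w s *\<^sub>R snd_blinfun" for w s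
  have fx_apply: "blinfun_apply (fx w s) = (\<lambda>d. A w s * fst d + B w s * snd d)" for w s
    by (auto simp: fx_def blinfun.add_left blinfun.scaleR_left)
  have hk: "continuous_on {0..1} (\<lambda>s. h s * k s)" and hl: "continuous_on {0..1} (\<lambda>s. h s * l s)"
    using h k l unfolding weight_def by (auto intro!: continuous_intros)
  note cf = smooth_on_continuous[OF f] smooth_on_continuous[OF smooth_on_pd(1)[OF f]]
    smooth_on_continuous[OF smooth_on_pd(2)[OF f]]
  have cA: "continuous_on (D \<times> {0..1}) (\<lambda>p. A (fst p) (snd p))"
    unfolding A_def using continuous_on_scaled[OF k l cf(2)]
    by (auto intro!: continuous_on_mult continuous_on_compose2[OF hk] continuous_on_snd
      simp: case_prod_unfold)
  have cB: "continuous_on (D \<times> {0..1}) (\<lambda>p. B (fst p) (snd p))"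
    unfolding B_def using continuous_on_scaled[OF k l cf(3)]
    by (auto intro!: continuous_on_mult continuous_on_compose2[OF hl] continuous_on_snd
      simp: case_prod_unfold)
  have deriv: "((\<lambda>w. integral (cbox 0 1) (\<lambda>s. h s * f (scaled_point k l w s))) has_derivative
      blinfun_apply (integral (cbox 0 1) (fx z))) (at z within D)"
  proof (rule leibniz_rule[where fx = fx])
    fix w s assume w: "w \<in> D" and s: "s \<in> cbox 0 (1::real)"
    have m: "scaled_point k l w s \<in> D"
      using scaled_point_mem[OF k l w, of s] s by simp
    have "((\<lambda>w. scaled_point k l w s) has_derivative (\<lambda>d. (k s * fst d, l s * snd d))) (at w)"
      unfolding scaled_point_def by (auto intro!: derivative_eq_intros)
    from has_derivative_compose[OF this smooth_on_has_derivative[OF open_D f m]]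
    have "((\<lambda>w. h s * f (scaled_point k l w s)) has_derivative
        (\<lambda>d. h s * (pd_fst f (scaled_point k l w s) * (k s * fst d)
                  + pd_snd f (scaled_point k l w s) * (l s * snd d)))) (at w)"
      by (auto intro!: has_derivative_mult_right)
    then show "((\<lambda>w. h s * f (scaled_point k l w s)) has_derivative blinfun_apply (fx w s)) (at w within D)"
      unfolding fx_apply A_def B_def by (simp add: algebra_simps has_derivative_at_withinI)
  next
    show "continuous_on (D \<times> cbox 0 1) (\<lambda>(w, s). fx w s)"
      using cA cB by (auto simp: fx_def case_prod_unfold intro!: continuous_intros)
  qed (use scaled_integrable(2)[OF k l h cf(1)] z convex_D in auto)
  have "((\<lambda>s. A z s) has_integral scaled_integral (\<lambda>s. h s * k s) k l (pd_fst f) z) {0..1}"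
    unfolding A_def scaled_integral_def
    by (rule integrable_integral[OF scaled_integrable(2)[OF k l hk cf(2) z]])
  moreover have "((\<lambda>s. B z s) has_integral scaled_integral (\<lambda>s. h s * l s) k l (pd_snd f) z) {0..1}"
    unfolding B_def scaled_integral_def
    by (rule integrable_integral[OF scaled_integrable(2)[OF k l hl cf(3) z]])
  ultimately have "((\<lambda>s. fx z s) has_integral
      scaled_integral (\<lambda>s. h s * k s) k l (pd_fst f) z *\<^sub>R fst_blinfun
      + scaled_integral (\<lambda>s. h s * l s) k l (pd_snd f) z *\<^sub>R snd_blinfun) {0..1}"
    unfolding fx_def by (rule has_integral_add[OF has_integral_scaleR_left has_integral_scaleR_left])
  then have I: "integral (cbox 0 1) (fx z) = scaled_integral (\<lambda>s. h s * k s) k l (pd_fst f) z *\<^sub>R fst_blinfun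
      + scaled_integral (\<lambda>s. h s * l s) k l (pd_snd f) z *\<^sub>R snd_blinfun"
    by (metis integral_unique cbox_interval)
  have "(\<lambda>w. integral (cbox 0 1) (\<lambda>s. h s * f (scaled_point k l w s))) = scaled_integral h k l f"
    by (simp add: fun_eq_iff scaled_integral_def)
  with deriv have "(scaled_integral h k l f has_derivative blinfun_apply (integral (cbox 0 1) (fx z))) (at z)"
    using at_within_open[OF z open_D] by simp
  then show ?thesis
    unfolding I by (rule has_derivative_eq_rhs) (simp add: fun_eq_iff blinfun.add_left blinfun.scaleR_left)
qed

text \<open>For fixed \<open>k\<close> and \<open>l\<close>, the scaled integrals over all
  continuous \<open>h\<close> and smooth \<open>f\<close> are closed under both derivatives.\<close>

lemma smooth_on_scaled_integral:
  assumes "weight k" "weight l" "continuous_on {0..1} h" "smooth_on D f"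
  shows "smooth_on D (scaled_integral h k l f)"
proof (rule smooth_on_coinduct[OF open_D,
    of _ "{scaled_integral h k l f |h f. continuous_on {0..1} h \<and> smooth_on D f}"])
  fix g assume "g \<in> {scaled_integral h k l f |h f. continuous_on {0..1} h \<and> smooth_on D f}"
  then obtain h f where g: "g = scaled_integral h k l f" and h: "continuous_on {0..1} h"
    and f: "smooth_on D f" by blast
  have "continuous_on {0..1} (\<lambda>s. h s * k s)" "continuous_on {0..1} (\<lambda>s. h s * l s)"
    using h assms unfolding weight_def by (auto intro!: continuous_intros)
  moreover note scaled_integral_has_derivative[OF assms(1,2) h f] smooth_on_pd[OF f]
  ultimately show "\<exists>a\<in>{scaled_integral h k l f |h f. continuous_on {0..1} h \<and> smooth_on D f}.
      \<exists>b\<in>{scaled_integral h k l f |h f. continuous_on {0..1} h \<and> smooth_on D f}.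
      \<forall>z\<in>D. (g has_derivative (\<lambda>h. a z * fst h + b z * snd h)) (at z)"
    unfolding g by blast
qed (use assms in blast)

lemma weight_simps [simp]: "weight (\<lambda>s. s)" "weight (\<lambda>s. 1)" "weight (\<lambda>s. 0)"
  by (auto simp: weight_def)

section \<open>Antiderivatives in \<open>x\<close>\<close>

lemmas scaled_integral_DERIV = DERIV_slice[OF scaled_integral_has_derivative]

lemma integral_DERIV:
  assumes "\<And>s. s \<in> {0..1} \<Longrightarrow> (f has_real_derivative f' s) (at s)"
  shows "integral {0..1} f' = f 1 - f 0"
  using assms by (intro integral_unique fundamental_theorem_of_calculus)
    (auto simp: has_real_derivative_iff_has_vector_derivative has_vector_derivative_at_within)

text \<open>Integrating along the segment instead of over \<open>{x0..x}\<close> keeps the domain of integration fixed.\<close>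

definition antideriv :: "field2 \<Rightarrow> field2" where
  "antideriv f z = (snd z - x0) * scaled_integral (\<lambda>_. 1) (\<lambda>_. 1) (\<lambda>s. s) f z"

lemma smooth_on_fst: "smooth_on D fst"
  and smooth_on_snd: "smooth_on D snd"
proof -
  have "smooth_on D f" if "f \<in> {fst, snd, \<lambda>_. 0, \<lambda>_. 1}" for f
  proof (rule smooth_on_coinduct[OF open_D that])
    fix f :: field2 assume "f \<in> {fst, snd, \<lambda>_. 0, \<lambda>_. 1}"
    moreover have "(fst has_derivative (\<lambda>h. 1 * fst h + 0 * snd h)) (at z)"
      "(snd has_derivative (\<lambda>h. 0 * fst h + 1 * snd h)) (at z)"
      "((\<lambda>_. c) has_derivative (\<lambda>h. 0 * fst h + 0 * snd h)) (at z)" for z :: "real \<times> real" and c :: real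
      by (auto intro!: derivative_eq_intros)
    ultimately show "\<exists>a\<in>{fst, snd, \<lambda>_. 0, \<lambda>_. 1}. \<exists>b\<in>{fst, snd, \<lambda>_. 0, \<lambda>_. 1}.
        \<forall>z\<in>D. (f has_derivative (\<lambda>h. a z * fst h + b z * snd h)) (at z)"
      by auto
  qed
  then show "smooth_on D fst" "smooth_on D snd" by simp_all
qed

lemma smooth_on_antideriv: "smooth_on D f \<Longrightarrow> smooth_on D (antideriv f)"
  unfolding antideriv_def[abs_def] by (intro smooth_intros open_D smooth_on_snd smooth_on_scaled_integral) auto

lemma pd_antideriv:
  assumes f: "smooth_on D f" and z: "z \<in> D"
  shows "pd_snd (antideriv f) z = f z" "pd_fst (antideriv f) z = antideriv (pd_fst f) z"
proof -
  obtain t x where tx: "z = (t, x)" by (cases z)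
  note d = scaled_integral_DERIV[OF weight_simps(2,1) _ f, of "\<lambda>_. 1", OF _ z[unfolded tx]]
  show "pd_fst (antideriv f) z = antideriv (pd_fst f) z"
    unfolding antideriv_def[abs_def] tx
    by (rule pd_eqI) (auto intro!: derivative_eq_intros d(1))
  let ?J = "scaled_integral (\<lambda>_. 1) (\<lambda>_. 1) (\<lambda>s. s) f z"
  let ?K = "scaled_integral (\<lambda>s. s) (\<lambda>_. 1) (\<lambda>s. s) (pd_snd f) z"
  have 1: "pd_snd (antideriv f) z = ?J + (x - x0) * ?K"
    unfolding antideriv_def[abs_def] tx
    by (rule pd_eqI) (auto intro!: derivative_eq_intros d(2))
  \<comment> \<open>The integrand is the derivative of \<open>s * f (t, x0 + s * (x - x0))\<close>
    in \<open>s\<close>. Its integral is \<open>f (t, x)\<close> by the end values and, term by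
    term, the product-rule expression for \<open>pd_snd (antideriv f)\<close>.\<close>
  have "integral {0..1} (\<lambda>s. f (t, x0 + s * (x - x0)) + s * (pd_snd f (t, x0 + s * (x - x0)) * (x - x0)))
      = 1 * f (t, x0 + 1 * (x - x0)) - 0 * f (t, x0 + 0 * (x - x0))"
  proof (rule integral_DERIV)
    fix s :: real assume s: "s \<in> {0..1}"
    have m: "(t, x0 + s * (x - x0)) \<in> D"
      using scaled_mem[OF int_X x0 _ s] z tx by (simp add: mem_D)
    show "((\<lambda>s. s * f (t, x0 + s * (x - x0))) has_real_derivative
        f (t, x0 + s * (x - x0)) + s * (pd_snd f (t, x0 + s * (x - x0)) * (x - x0))) (at s)"
      by (rule derivative_eq_intros DERIV_chain2[where f = "\<lambda>s. f (t, s)" and g = "\<lambda>s. x0 + s * (x - x0)" and x = s, OF DERIV_pd(2)[OF open_D f m]] refl | simp)+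
  qed
  moreover have "integral {0..1} (\<lambda>s. f (t, x0 + s * (x - x0)) + s * (pd_snd f (t, x0 + s * (x - x0)) * (x - x0)))
      = ?J + ?K * (x - x0)"
    using scaled_integrable(2)[OF weight_simps(2,1) _ smooth_on_continuous[OF f] z, of "\<lambda>_. 1"]
      scaled_integrable(2)[OF weight_simps(2,1) _ smooth_on_continuous[OF smooth_on_pd(2)[OF f]] z, of "\<lambda>s. s"]
    by (intro integral_unique) (auto intro!: has_integral_add has_integral_mult_left
        simp: has_integral_integral scaled_integral_def scaled_point_def tx mult.assoc[symmetric])
  ultimately show "pd_snd (antideriv f) z = f z"
    unfolding 1 by (simp add: tx algebra_simps)
qed

section \<open>Symmetry of mixed derivatives and the Poincare lemma\<close>

lemma DERIV_zero_slice:
  assumes "\<And>z. z \<in> D \<Longrightarrow> pd_snd f z = 0" "smooth_on D f" "(t, x) \<in> D" "(t, x') \<in> D"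
  shows "f (t, x) = f (t, x')"
proof -
  have "((\<lambda>s. f (t, s)) has_real_derivative 0) (at s within X)" if "s \<in> X" for s
    using DERIV_pd(2)[OF open_D assms(2), of t s] assms(1,3) that
    by (auto simp: mem_D intro: has_field_derivative_at_within)
  then show ?thesis
    using has_field_derivative_zero_constant[of X "\<lambda>s. f (t, s)"] is_interval_convex[OF int_X] assms(3,4)
    by (auto simp: mem_D)
qed

text \<open>The field \<open>f\<close> and the antiderivative \<open>G\<close> of its
  \<open>x\<close>-derivative differ by a function of \<open>t\<close> alone, so their
  \<open>t\<close>-derivatives have the same \<open>x\<close>-derivative. For \<open>G\<close> the
  symmetry holds because the \<open>t\<close>-derivative passes under the integral.\<close>

lemma pd_commute:
  assumes f: "smooth_on D f" and z: "z \<in> D"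
  shows "pd_fst (pd_snd f) z = pd_snd (pd_fst f) z"
proof -
  obtain t x where tx: "z = (t, x)" by (cases z)
  define G where "G = antideriv (pd_snd f)"
  have G: "smooth_on D G"
    unfolding G_def by (intro smooth_on_antideriv smooth_on_pd f)
  have pG: "pd_snd G w = pd_snd f w" if "w \<in> D" for w
    unfolding G_def using that f by (intro pd_antideriv smooth_on_pd)
  define e where "e w = f w - G w" for w
  have e: "smooth_on D e"
    unfolding e_def[abs_def] using f G by (intro smooth_intros open_D)
  have "pd_snd e (t, x) = 0" if "(t, x) \<in> D" for t x
    unfolding e_def[abs_def]
    by (rule pd_eqI) (use that in \<open>auto intro!: derivative_eq_intros DERIV_pd[OF open_D] f G simp: pG\<close>)
  then have e_const: "e (s, x) = e (s, x0)" if "(s, x) \<in> D" for s x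
    by (intro DERIV_zero_slice e) (use that x0 in \<open>auto simp: mem_D\<close>)
  \<comment> \<open>At all times in the open set \<open>T\<close>, \<open>e\<close> takes at
    \<open>x\<close> the same value as at \<open>x0\<close>, so its time derivative does
    too.\<close>
  have "pd_fst e (s, x) = pd_fst e (s, x0)" if "(s, x) \<in> D" for s x
  proof (rule pd_eqI)
    have "((\<lambda>s. e (s, x0)) has_real_derivative pd_fst e (s, x0)) (at s)"
      by (rule DERIV_pd[OF open_D e]) (use that x0 in \<open>auto simp: mem_D\<close>)
    then show "((\<lambda>s. e (s, x)) has_real_derivative pd_fst e (s, x0)) (at s)"
      by (rule has_field_derivative_transform_within_open[OF _ open_T])
        (use that e_const in \<open>auto simp: mem_D\<close>)
  qed
  then have "pd_snd (pd_fst e) z = pd_snd (\<lambda>w. pd_fst e (fst w, x0)) z"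
    by (intro pd_cong(2)[OF open_D z]) auto
  then have "pd_snd (pd_fst e) z = 0"
    by (simp add: pd_snd_def tx)
  have "pd_fst e w = pd_fst f w - pd_fst G w" if "w \<in> D" for w
    unfolding e_def[abs_def] using that
    by (cases w) (auto intro!: pd_eqI derivative_eq_intros DERIV_pd[OF open_D] f G)
  then have "pd_snd (pd_fst e) z = pd_snd (\<lambda>w. pd_fst f w - pd_fst G w) z"
    by (intro pd_cong(2)[OF open_D z]) auto
  also have "\<dots> = pd_snd (pd_fst f) z - pd_snd (pd_fst G) z"
    unfolding tx by (rule pd_eqI)
      (use z in \<open>auto intro!: derivative_eq_intros DERIV_pd[OF open_D] smooth_on_pd f G simp: tx\<close>)
  also have "pd_snd (pd_fst G) z = pd_snd (antideriv (pd_fst (pd_snd f))) z"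
    unfolding G_def by (intro pd_cong(2)[OF open_D z] pd_antideriv smooth_on_pd f)
  also have "\<dots> = pd_fst (pd_snd f) z"
    by (intro pd_antideriv smooth_on_pd f z)
  finally show ?thesis
    using \<open>pd_snd (pd_fst e) z = 0\<close> by simp
qed

text \<open>This is the Poincare lemma on a rectangle. It later supplies the new coordinate from
  prescribed \<open>y\<^sub>t\<close> and \<open>y\<^sub>x\<close>.\<close>

lemma potential_exists:
  assumes a: "smooth_on D a" and b: "smooth_on D b"
    and ab: "\<And>z. z \<in> D \<Longrightarrow> pd_snd a z = pd_fst b z"
  obtains y where "smooth_on D y" "\<And>z. z \<in> D \<Longrightarrow> pd_fst y z = a z" "\<And>z. z \<in> D \<Longrightarrow> pd_snd y z = b z"
proof -
  \<comment> \<open>The form \<open>a dt + b dx\<close> is integrated first along \<open>t\<close>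
    at \<open>x0\<close>, then along \<open>x\<close> at fixed \<open>t\<close>.\<close>
  define y where "y z = (fst z - t0) * scaled_integral (\<lambda>_. 1) (\<lambda>s. s) (\<lambda>_. 0) a z + antideriv b z" for z
  have y: "smooth_on D y"
    unfolding y_def[abs_def]
    by (intro smooth_intros open_D smooth_on_fst smooth_on_antideriv smooth_on_scaled_integral a b) auto
  have "pd_fst y z = a z \<and> pd_snd y z = b z" if "z \<in> D" for z
  proof -
    obtain t x where tx: "z = (t, x)" by (cases z)
    note z = that[unfolded tx]
    have z0: "(t, x0) \<in> D" using z x0 by (simp add: mem_D)
    let ?J = "scaled_integral (\<lambda>_. 1) (\<lambda>s. s) (\<lambda>_. 0) a (t, x)"
    let ?K = "scaled_integral (\<lambda>s. s) (\<lambda>s. s) (\<lambda>_. 0) (pd_fst a) (t, x)"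
    note d = scaled_integral_DERIV[OF weight_simps(1,3) _ a z, of "\<lambda>_. 1"]
    note da = DERIV_pd[OF open_D smooth_on_antideriv[OF b] z]
    have 2: "pd_snd y (t, x) = b (t, x)"
      unfolding y_def[abs_def]
      by (rule pd_eqI)
        (rule derivative_eq_intros d(2) da(2) refl continuous_intros
          | simp add: pd_antideriv[OF b z] scaled_integral_def)+
    have 1: "pd_fst y (t, x) = ?J + (t - t0) * ?K + antideriv (pd_fst b) (t, x)"
      unfolding y_def[abs_def]
      by (rule pd_eqI)
        (rule derivative_eq_intros d(1) da(1) refl continuous_intros
          | simp add: pd_antideriv[OF b z])+
    have "integral {0..1} (\<lambda>s. a (t0 + s * (t - t0), x0) + s * (pd_fst a (t0 + s * (t - t0), x0) * (t - t0)))
        = 1 * a (t0 + 1 * (t - t0), x0) - 0 * a (t0 + 0 * (t - t0), x0)"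
    proof (rule integral_DERIV)
      fix s :: real assume s: "s \<in> {0..1}"
      have m: "(t0 + s * (t - t0), x0) \<in> D"
        using scaled_mem[OF int_T t0 _ s] z x0 by (simp add: mem_D)
      show "((\<lambda>s. s * a (t0 + s * (t - t0), x0)) has_real_derivative
          a (t0 + s * (t - t0), x0) + s * (pd_fst a (t0 + s * (t - t0), x0) * (t - t0))) (at s)"
        by (rule derivative_eq_intros DERIV_chain2[where f = "\<lambda>s. a (s, x0)" and g = "\<lambda>s. t0 + s * (t - t0)" and x = s, OF DERIV_pd(1)[OF open_D a m]] refl | simp)+
    qed
    moreover have "integral {0..1} (\<lambda>s. a (t0 + s * (t - t0), x0) + s * (pd_fst a (t0 + s * (t - t0), x0) * (t - t0)))
        = ?J + ?K * (t - t0)"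
      using scaled_integrable(2)[OF weight_simps(1,3) _ smooth_on_continuous[OF a] z, of "\<lambda>_. 1"]
        scaled_integrable(2)[OF weight_simps(1,3) _ smooth_on_continuous[OF smooth_on_pd(1)[OF a]] z, of "\<lambda>s. s"]
      by (intro integral_unique) (auto intro!: has_integral_add has_integral_mult_left
          simp: has_integral_integral scaled_integral_def scaled_point_def mult.assoc[symmetric])
    ultimately have J: "?J + (t - t0) * ?K = a (t, x0)"
      by (simp add: algebra_simps)
    \<comment> \<open>By the compatibility condition \<open>c\<close> does not depend on
      \<open>x\<close>. As \<open>antideriv\<close> vanishes at \<open>x0\<close>, its value is
      \<open>- a (t, x0)\<close>, which cancels the contribution of the first leg of the
      path.\<close>
    define c where "c w = antideriv (pd_fst b) w - a w" for w
    have c: "smooth_on D c"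
      unfolding c_def[abs_def] by (intro smooth_intros smooth_on_antideriv open_D a b)
    have "pd_snd c w = 0" if "w \<in> D" for w
    proof -
      obtain t x where w: "w = (t, x)" by (cases w)
      have "pd_snd c (t, x) = pd_snd (antideriv (pd_fst b)) (t, x) - pd_snd a (t, x)"
        unfolding c_def[abs_def] using that w
        by (auto intro!: pd_eqI derivative_eq_intros DERIV_pd[OF open_D] smooth_on_antideriv smooth_on_pd a b)
      then show ?thesis
        using pd_antideriv(1)[OF smooth_on_pd(1)[OF b] that] ab[OF that] w by simp
    qed
    from DERIV_zero_slice[OF this c z z0]
    have "antideriv (pd_fst b) (t, x) = a (t, x) - a (t, x0)"
      by (simp add: c_def antideriv_def)
    with 1 2 J tx show ?thesis by simp
  qed
  with y that show thesis by blast
qed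

end

subsection \<open>Change of variable and the dual hierarchy\<close>

locale change_of_variable = strip +
  fixes y :: field2
  assumes smooth_y: "smooth_on D y" and y_pos: "\<And>z. z \<in> D \<Longrightarrow> pd_snd y z > 0"
begin

definition new_point :: "real \<times> real \<Rightarrow> real \<times> real" where
  "new_point = (\<lambda>(t, x). (t, y (t, x)))"

text \<open>\<open>inv_into\<close> inverts the change of variable on \<open>new_domain D y\<close>
  and is arbitrary outside it, so derivatives of pull-backs are computed on that domain
  only.\<close>

definition pull :: "field2 \<Rightarrow> field2" where
  "pull g z = g (inv_into D new_point z)"

lemma new_domain_eq: "new_domain D y = new_point ` D"
  by (simp add: new_domain_def new_point_def)

text \<open>As \<open>X\<close> is an interval and \<open>y\<^sub>x\<close> is positive,
  \<open>y\<close> is strictly increasing on each slice of constant \<open>t\<close>.\<close>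

lemma inj_new_point: "inj_on new_point D"
proof (rule inj_onI)
  fix p q assume p: "p \<in> D" and q: "q \<in> D" and eq: "new_point p = new_point q"
  obtain t x x' where px: "p = (t, x)" and qx: "q = (t, x')" and y: "y (t, x) = y (t, x')"
    using eq by (cases p; cases q) (auto simp: new_point_def)
  have "y (t, c) < y (t, d)" if "c < d" "(t, c) \<in> D" "(t, d) \<in> D" for c d
  proof (rule DERIV_pos_imp_increasing[OF that(1)])
    fix s assume "c \<le> s" "s \<le> d"
    then have "(t, s) \<in> D"
      using that int_X by (auto simp: mem_D intro: mem_is_interval_1_I)
    then show "\<exists>m. ((\<lambda>s. y (t, s)) has_real_derivative m) (at s) \<and> 0 < m"
      using DERIV_pd(2)[OF open_D smooth_y] y_pos by blast
  qed
  from this[of x x'] this[of x' x] show "p = q"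
    using p q y unfolding px qx by (cases x x' rule: linorder_cases) auto
qed

lemma pull_new_point [simp]: "z \<in> D \<Longrightarrow> pull g (new_point z) = g z"
  by (simp add: pull_def inv_into_f_f[OF inj_new_point])

lemma has_derivative_new_point:
  assumes "z \<in> D"
  shows "(new_point has_derivative (\<lambda>h. (fst h, pd_fst y z * fst h + pd_snd y z * snd h))) (at z)"
proof -
  have "new_point = (\<lambda>p. (fst p, y p))"
    by (auto simp: new_point_def)
  then show ?thesis
    by (auto intro!: derivative_eq_intros smooth_on_has_derivative[OF open_D smooth_y assms])
qed

lemma continuous_on_new_point: "continuous_on D new_point"
  using has_derivative_continuous[OF has_derivative_new_point]
  by (simp add: continuous_at_imp_continuous_on)

text \<open>Invariance of domain, for a continuous injective map of the plane.\<close>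

lemma open_new_domain: "open (new_domain D y)"
  unfolding new_domain_eq
  by (rule invariance_of_domain_gen[OF open_D continuous_on_new_point inj_new_point]) simp

text \<open>The Jacobian has rows \<open>(1, 0)\<close> and \<open>(y\<^sub>t, y\<^sub>x)\<close>.
  Inverting it gives the chain rule: the \<open>y\<close>-derivative is the
  \<open>x\<close>-derivative divided by \<open>y\<^sub>x\<close>, and the
  \<open>\<tau>\<close>-derivative is the \<open>t\<close>-derivative minus
  \<open>y\<^sub>t / y\<^sub>x\<close> times the \<open>x\<close>-derivative.\<close>

lemma has_derivative_pull:
  assumes g: "smooth_on D g" and z: "z \<in> D"
  shows "(pull g has_derivative (\<lambda>h. (pd_fst g z - pd_fst y z / pd_snd y z * pd_snd g z) * fst h
    + pd_snd g z / pd_snd y z * snd h)) (at (new_point z))"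
proof -
  let ?i = "\<lambda>h. (fst h, (snd h - pd_fst y z * fst h) / pd_snd y z)"
  have "(inv_into D new_point has_derivative ?i) (at (new_point z))"
  proof (rule has_derivative_inverse_strong[OF open_D z continuous_on_new_point _ has_derivative_new_point[OF z]])
    show "(\<lambda>h. (fst h, pd_fst y z * fst h + pd_snd y z * snd h)) \<circ> ?i = id"
      using y_pos[OF z] by (auto simp: fun_eq_iff)
  qed (simp add: inv_into_f_f[OF inj_new_point])
  moreover have "(g has_derivative (\<lambda>h. pd_fst g z * fst h + pd_snd g z * snd h))
      (at (inv_into D new_point (new_point z)))"
    using smooth_on_has_derivative[OF open_D g z] z by (simp add: inv_into_f_f[OF inj_new_point])
  ultimately have "((\<lambda>w. g (inv_into D new_point w)) has_derivative
      (\<lambda>h. pd_fst g z * fst (?i h) + pd_snd g z * snd (?i h))) (at (new_point z))"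
    by (rule has_derivative_compose)
  then show ?thesis
    unfolding pull_def[abs_def]
    by (rule has_derivative_eq_rhs) (simp add: fun_eq_iff algebra_simps diff_divide_distrib)
qed

lemmas pd_pull = has_derivative_pd_unique[OF has_derivative_pull]

text \<open>The pull-backs of smooth fields are closed under both derivatives, so their smoothness needs
  no smoothness of the inverse change of variable beyond differentiability.\<close>

lemma smooth_on_pull:
  assumes "smooth_on D g"
  shows "smooth_on (new_domain D y) (pull g)"
proof (rule smooth_on_coinduct[OF open_new_domain, of _ "{pull g |g. smooth_on D g}"])
  fix f assume "f \<in> {pull g |g. smooth_on D g}"
  then obtain g where f: "f = pull g" and g: "smooth_on D g" by blast
  let ?a = "\<lambda>z. pd_fst g z - pd_fst y z / pd_snd y z * pd_snd g z"
  let ?b = "\<lambda>z. pd_snd g z / pd_snd y z"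
  have ne: "pd_snd y z \<noteq> 0" if "z \<in> D" for z
    using y_pos[OF that] by simp
  have "smooth_on D ?a" "smooth_on D ?b"
    by (intro smooth_intros open_D g smooth_y ne; assumption)+
  moreover have "\<forall>z\<in>new_domain D y. (f has_derivative (\<lambda>h. pull ?a z * fst h + pull ?b z * snd h)) (at z)"
    using has_derivative_pull[OF g] unfolding new_domain_eq f by simp
  ultimately show "\<exists>a\<in>{pull g |g. smooth_on D g}. \<exists>b\<in>{pull g |g. smooth_on D g}.
      \<forall>z\<in>new_domain D y. (f has_derivative (\<lambda>h. a z * fst h + b z * snd h)) (at z)"
    by blast
qed (use assms in blast)

end

text \<open>The orbits constructed below start at fields that agree with the flow or with
  \<open>(Q\<^sub>y, P\<^sub>y)\<close> only on the new domain. The graph depends on its argument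
  only through values on an open set.\<close>

lemma Rbar_graph_veq_left:
  assumes D: "open D" and uv: "(u, v) \<in> Rbar_graph D Q P" and eq: "veq_on D u u'"
  shows "(u', v) \<in> Rbar_graph D Q P"
proof -
  obtain q p where u: "u = (q, p)" by (cases u)
  obtain q' p' where u': "u' = (q', p')" by (cases u')
  have e: "q z = q' z" "p z = p' z" if "z \<in> D" for z
    using eq that by (auto simp: veq_on_def u u')
  have "vsmooth_on D u'"
    using uv smooth_on_cong[OF D] e by (auto simp: Rbar_graph_def vsmooth_on_def u u')
  have e1: "pd_snd p z = pd_snd p' z" if "z \<in> D" for z
    using pd_cong[OF D that] e by blast
  have "pd_snd (P * q) z = pd_snd (P * q') z"
    "pd_snd (Q * p - pd_snd p) z = pd_snd (Q * p' - pd_snd p') z" if "z \<in> D" for z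
    using that by (auto intro!: pd_cong(2)[OF D] simp: e e1)
  with uv \<open>vsmooth_on D u'\<close> show ?thesis
    by (simp add: Rbar_graph_def u u' Let_def veq_on_def X_op_def Y_op_def e e1)
qed

text \<open>For positive \<open>k\<close> only the first link sees the starting field, and the end
  stays \<open>v\<close>. For \<open>k = 0\<close> there is no link, so the end has to change with
  the start.\<close>

lemma Rbar_relpow_veq_left:
  assumes D: "open D" and uv: "(u, v) \<in> Rbar_graph D Q P ^^ k" and eq: "veq_on D u u'"
  obtains v' where "veq_on D v v'" "(u', v') \<in> Rbar_graph D Q P ^^ k"
proof (cases k)
  case 0
  then show ?thesis using uv eq that[of u'] by simp
next
  case (Suc j)
  then obtain w where w: "(u, w) \<in> Rbar_graph D Q P" "(w, v) \<in> Rbar_graph D Q P ^^ j"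
    using uv relpow_Suc_E2 by metis
  then show ?thesis
    using that[of v] Rbar_graph_veq_left[OF D w(1) eq] relpow_Suc_I2[of u' w _ v j] Suc
    by (simp add: veq_on_def)
qed

section \<open>The operator \<open>K\<close> and the chains of a dual solution\<close>

locale dual_fields = strip +
  fixes \<rho> \<gamma> :: field2
  assumes smooth_\<rho>: "smooth_on D \<rho>" and smooth_\<gamma>: "smooth_on D \<gamma>"
    and pos: "\<And>z. z \<in> D \<Longrightarrow> 4 * \<rho> z - (\<gamma> z)\<^sup>2 > 0"
begin

abbreviation \<omega> :: field2 where "\<omega> \<equiv> omega \<rho> \<gamma>"

lemma omega_pos: "z \<in> D \<Longrightarrow> \<omega> z > 0" "z \<in> D \<Longrightarrow> \<omega> z \<noteq> 0"
  using pos[of z] by (auto simp: omega_def)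

lemma omega_sq: "z \<in> D \<Longrightarrow> (\<omega> z)\<^sup>2 = 4 * \<rho> z - (\<gamma> z)\<^sup>2"
  using pos[of z] by (simp add: omega_def)

lemma smooth_omega: "smooth_on D \<omega>"
  unfolding omega_def
  by (intro smooth_intros open_D smooth_\<rho> smooth_\<gamma> pos)

text \<open>Differentiating \<open>(\<omega> z)\<^sup>2\<close> instead of \<open>\<omega>\<close>
  keeps the square root out of the formulas.\<close>

lemma pd_omega:
  assumes "z \<in> D"
  shows "\<omega> z * pd_fst \<omega> z = 2 * pd_fst \<rho> z - \<gamma> z * pd_fst \<gamma> z"
    and "\<omega> z * pd_snd \<omega> z = 2 * pd_snd \<rho> z - \<gamma> z * pd_snd \<gamma> z"
proof -
  obtain t x where z: "z = (t, x)" by (cases z)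
  note d = DERIV_pd[OF open_D _ assms[unfolded z]]
  have cong: "pd_fst (\<lambda>z. (\<omega> z)\<^sup>2) z = pd_fst (\<lambda>z. 4 * \<rho> z - (\<gamma> z)\<^sup>2) z"
    "pd_snd (\<lambda>z. (\<omega> z)\<^sup>2) z = pd_snd (\<lambda>z. 4 * \<rho> z - (\<gamma> z)\<^sup>2) z"
    by (intro pd_cong[OF open_D assms] omega_sq; assumption)+
  have "pd_fst (\<lambda>z. (\<omega> z)\<^sup>2) z = 2 * \<omega> z * pd_fst \<omega> z" "pd_snd (\<lambda>z. (\<omega> z)\<^sup>2) z = 2 * \<omega> z * pd_snd \<omega> z"
    "pd_fst (\<lambda>z. 4 * \<rho> z - (\<gamma> z)\<^sup>2) z = 4 * pd_fst \<rho> z - 2 * \<gamma> z * pd_fst \<gamma> z"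
    "pd_snd (\<lambda>z. 4 * \<rho> z - (\<gamma> z)\<^sup>2) z = 4 * pd_snd \<rho> z - 2 * \<gamma> z * pd_snd \<gamma> z"
    unfolding z by (rule pd_eqI; auto intro!: derivative_eq_intros d smooth_omega smooth_\<rho> smooth_\<gamma>)+
  with cong show "\<omega> z * pd_fst \<omega> z = 2 * pd_fst \<rho> z - \<gamma> z * pd_fst \<gamma> z"
    "\<omega> z * pd_snd \<omega> z = 2 * pd_snd \<rho> z - \<gamma> z * pd_snd \<gamma> z"
    by simp_all
qed

lemma pd_times:
  assumes "smooth_on D f" "smooth_on D g" "z \<in> D"
  shows "pd_fst (\<lambda>z. f z * g z) z = pd_fst f z * g z + f z * pd_fst g z"
    and "pd_snd (\<lambda>z. f z * g z) z = pd_snd f z * g z + f z * pd_snd g z"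
  using assms(3)
  by (cases z; simp only:; intro pd_eqI; auto intro!: derivative_eq_intros DERIV_pd[OF open_D] assms)+

lemma K_op_apply:
  assumes "smooth_on D a" "z \<in> D"
  shows "fst (K_op \<rho> \<gamma> (a, b)) z = 2 * \<rho> z * pd_snd a z + pd_snd \<rho> z * a z + \<gamma> z * pd_snd b z"
    and "snd (K_op \<rho> \<gamma> (a, b)) z = pd_snd \<gamma> z * a z + \<gamma> z * pd_snd a z + 2 * pd_snd b z"
  using pd_times[OF smooth_\<rho> assms] pd_times[OF smooth_\<gamma> assms]
  by (simp_all add: K_op_def times_fun_def)

text \<open>In twice the first row minus \<open>\<gamma>\<close> times the second, the terms in
  \<open>b\<close> cancel and \<open>\<omega>\<close> times the \<open>x\<close>-derivative of
  \<open>\<omega> * a\<close> remains. This identity drives the solvability of \<open>K\<close>, the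
  conservation law for \<open>\<omega>\<close> and the recursion step.\<close>

lemma K_op_omega:
  assumes "smooth_on D a" "z \<in> D"
  shows "\<omega> z * (pd_snd \<omega> z * a z + \<omega> z * pd_snd a z)
    = 2 * fst (K_op \<rho> \<gamma> (a, b)) z - \<gamma> z * snd (K_op \<rho> \<gamma> (a, b)) z"
proof -
  have "\<omega> z * (pd_snd \<omega> z * a z + \<omega> z * pd_snd a z)
      = (\<omega> z * pd_snd \<omega> z) * a z + (\<omega> z)\<^sup>2 * pd_snd a z"
    by (simp add: algebra_simps power2_eq_square)
  also have "\<dots> = 2 * fst (K_op \<rho> \<gamma> (a, b)) z - \<gamma> z * snd (K_op \<rho> \<gamma> (a, b)) z"
    unfolding pd_omega[OF assms(2)] omega_sq[OF assms(2)] K_op_apply[OF assms]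
    by (simp add: algebra_simps power2_eq_square)
  finally show ?thesis .
qed

text \<open>The system is triangular: \<open>K_op_omega\<close> prescribes the
  \<open>x\<close>-derivative \<open>e\<close> of \<open>\<omega> * a\<close>, and then the second
  row prescribes the \<open>x\<close>-derivative \<open>c\<close> of \<open>b\<close>. Both are
  integrated from \<open>x0\<close>.\<close>

lemma K_op_solvable:
  assumes m: "vsmooth_on D m"
  obtains a b where "smooth_on D a" "smooth_on D b" "veq_on D m (K_op \<rho> \<gamma> (a, b))"
proof -
  obtain m1 m2 where m12: "m = (m1, m2)" "smooth_on D m1" "smooth_on D m2"
    using m by (cases m) (auto simp: vsmooth_on_def)
  define e where "e z = (2 * m1 z - \<gamma> z * m2 z) / \<omega> z" for z
  have e: "smooth_on D e"
    unfolding e_def[abs_def] by (intro smooth_intros open_D m12 smooth_\<gamma> smooth_omega omega_pos)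
  define a where "a z = antideriv e z / \<omega> z" for z
  have a: "smooth_on D a"
    unfolding a_def[abs_def] by (intro smooth_intros open_D smooth_on_antideriv e smooth_omega omega_pos)
  define c where "c z = (m2 z - (pd_snd \<gamma> z * a z + \<gamma> z * pd_snd a z)) / 2" for z
  have c: "smooth_on D c"
    unfolding c_def[abs_def] by (intro smooth_intros open_D m12 smooth_\<gamma> a) simp
  define b where "b = antideriv c"
  have b: "smooth_on D b"
    unfolding b_def by (intro smooth_on_antideriv c)
  have "m1 z = fst (K_op \<rho> \<gamma> (a, b)) z \<and> m2 z = snd (K_op \<rho> \<gamma> (a, b)) z" if z: "z \<in> D" for z
  proof
    show 2: "m2 z = snd (K_op \<rho> \<gamma> (a, b)) z"
      unfolding K_op_apply[OF a z] b_def pd_antideriv[OF c z] c_def by (simp add: field_simps)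
    have "pd_snd (\<lambda>z. \<omega> z * a z) z = pd_snd (antideriv e) z"
      by (rule pd_cong(2)[OF open_D z]) (simp add: a_def omega_pos)
    then have "pd_snd \<omega> z * a z + \<omega> z * pd_snd a z = e z"
      by (simp add: pd_times[OF smooth_omega a z] pd_antideriv[OF e z])
    then show "m1 z = fst (K_op \<rho> \<gamma> (a, b)) z"
      using K_op_omega[OF a z, of b] omega_pos[OF z] 2 by (simp add: e_def)
  qed
  with a b that show thesis by (simp add: veq_on_def m12)
qed

text \<open>A link is a value of \<open>K\<^sup>-\<^sup>1 J\<close>, for any integration constants.
  Forwards it is the recursion towards negative indices, backwards the one towards positive indices,
  so one relation serves both.\<close>

definition step :: "(vfield2 \<times> vfield2) set" where
  "step = {(w, w'). vsmooth_on D w \<and> vsmooth_on D w' \<and> veq_on D (K_op \<rho> \<gamma> w') (J_op w)}"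

lemma K_op_one_zero: "z \<in> D \<Longrightarrow> fst (K_op \<rho> \<gamma> (1, 0)) z = pd_snd \<rho> z \<and> snd (K_op \<rho> \<gamma> (1, 0)) z = pd_snd \<gamma> z"
proof -
  have "pd_snd 1 = 0" "pd_snd 0 = 0"
    by (auto simp: pd_snd_def one_fun_def zero_fun_def)
  then show "z \<in> D \<Longrightarrow> ?thesis"
    using K_op_apply[OF smooth_on_const[OF open_D, of 1], of z 0]
    by (simp add: one_fun_def zero_fun_def)
qed

lemma smooth_one_zero: "vsmooth_on D (1, 0)"
  by (simp add: vsmooth_on_def one_fun_def zero_fun_def smooth_on_const open_D)

text \<open>As \<open>(\<rho>\<^sub>x, \<gamma>\<^sub>x)\<close> is \<open>K (1, 0)\<close>, the
  word \<open>(K J\<^sup>-\<^sup>1)\<^sup>k K\<close> regroups as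
  \<open>K (J\<^sup>-\<^sup>1 K)\<^sup>k\<close>. Each factor \<open>J\<^sup>-\<^sup>1 K\<close> is
  a reversed link, so the chain ends at \<open>(1, 0)\<close>.\<close>

lemma flux_positive:
  assumes "((pd_snd \<rho>, pd_snd \<gamma>), M) \<in> ((graph_on D J_op)\<inverse> O graph_on D (K_op \<rho> \<gamma>)) ^^ k"
  shows "\<exists>w. vsmooth_on D w \<and> veq_on D M (K_op \<rho> \<gamma> w) \<and> (w, (1, 0)) \<in> step ^^ k"
  using assms
proof (induction k arbitrary: M)
  case 0
  then show ?case
    using K_op_one_zero smooth_one_zero by (intro exI[of _ "(1, 0)"]) (auto simp: veq_on_def)
next
  case (Suc k)
  from Suc.prems obtain M' w where M': "((pd_snd \<rho>, pd_snd \<gamma>), M') \<in> ((graph_on D J_op)\<inverse> O graph_on D (K_op \<rho> \<gamma>)) ^^ k"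
    and w: "(w, M') \<in> graph_on D J_op" "(w, M) \<in> graph_on D (K_op \<rho> \<gamma>)"
    by auto
  from Suc.IH[OF M'] obtain w' where w': "vsmooth_on D w'" "veq_on D M' (K_op \<rho> \<gamma> w')" "(w', (1, 0)) \<in> step ^^ k"
    by blast
  have "(w, w') \<in> step"
    using w w'(1,2) by (simp add: step_def graph_on_def veq_on_def)
  note relpow_Suc_I2[OF this w'(3)]
  moreover have "vsmooth_on D w" "veq_on D M (K_op \<rho> \<gamma> w)"
    using w by (simp_all add: graph_on_def)
  ultimately show ?case by blast
qed

text \<open>Here \<open>(J K\<^sup>-\<^sup>1)\<^sup>k J\<close> regroups as
  \<open>J (K\<^sup>-\<^sup>1 J)\<^sup>k\<close>, so the links are read forwards from
  \<open>w0\<close>.\<close>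

lemma flux_negative:
  assumes "(J_op w0, M) \<in> ((graph_on D (K_op \<rho> \<gamma>))\<inverse> O graph_on D J_op) ^^ k" "vsmooth_on D w0"
  shows "\<exists>w. vsmooth_on D w \<and> veq_on D M (J_op w) \<and> (w0, w) \<in> step ^^ k"
  using assms(1)
proof (induction k arbitrary: M)
  case 0
  then show ?case
    using assms(2) by (intro exI[of _ w0]) (auto simp: veq_on_def)
next
  case (Suc k)
  from Suc.prems obtain M' w where M': "(J_op w0, M') \<in> ((graph_on D (K_op \<rho> \<gamma>))\<inverse> O graph_on D J_op) ^^ k"
    and w: "(w, M') \<in> graph_on D (K_op \<rho> \<gamma>)" "(w, M) \<in> graph_on D J_op"
    by auto
  from Suc.IH[OF M'] obtain w' where w': "vsmooth_on D w'" "veq_on D M' (J_op w')" "(w0, w') \<in> step ^^ k"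
    by blast
  have "(w', w) \<in> step"
    using w w'(1,2) by (simp add: step_def graph_on_def veq_on_def)
  note relpow_Suc_I[OF w'(3) this]
  moreover have "vsmooth_on D w" "veq_on D M (J_op w)"
    using w by (simp_all add: graph_on_def)
  ultimately show ?case by blast
qed

lemma smooth_casimir: "vsmooth_on D (casimir_grad \<rho> \<gamma>)"
  unfolding vsmooth_on_def casimir_grad_def
  by (auto intro!: smooth_intros open_D smooth_omega smooth_\<gamma> simp: omega_pos)

lemma pd_divide_omega:
  assumes "smooth_on D f" "z \<in> D"
  shows "pd_fst (\<lambda>z. f z / \<omega> z) z = (pd_fst f z * \<omega> z - f z * pd_fst \<omega> z) / (\<omega> z)\<^sup>2"
    and "pd_snd (\<lambda>z. f z / \<omega> z) z = (pd_snd f z * \<omega> z - f z * pd_snd \<omega> z) / (\<omega> z)\<^sup>2"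
  using assms(2) omega_pos[OF assms(2)]
  by (cases z; simp only:; intro pd_eqI; auto intro!: derivative_eq_intros DERIV_pd[OF open_D] assms smooth_omega
      simp: power2_eq_square)+

lemma casimir_grad_eq_divide:
  "casimir_grad \<rho> \<gamma> = (\<lambda>z. - 1 / \<omega> z, \<lambda>z. (\<gamma> z / 2) / \<omega> z)"
  by (simp add: casimir_grad_def)

text \<open>For \<open>a = -1/\<omega>\<close> and \<open>b = \<gamma>/(2\<omega>)\<close>, the
  product \<open>\<omega> a\<close> is constant and \<open>\<gamma> a + 2 b\<close> vanishes. Hence
  the combination in \<open>K_op_omega\<close> and the second row are both zero.\<close>

lemma K_op_casimir:
  assumes "z \<in> D"
  shows "fst (K_op \<rho> \<gamma> (casimir_grad \<rho> \<gamma>)) z = 0 \<and> snd (K_op \<rho> \<gamma> (casimir_grad \<rho> \<gamma>)) z = 0"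
proof -
  note ne = omega_pos(2)[OF assms]
  have g2: "smooth_on D (\<lambda>z. \<gamma> z / 2)"
    by (intro smooth_intros open_D smooth_\<gamma>) simp
  have p2: "pd_snd (\<lambda>z. \<gamma> z / 2) z = pd_snd \<gamma> z / 2"
    using assms by (cases z; simp only:; intro pd_eqI)
      (auto intro!: derivative_eq_intros DERIV_pd[OF open_D] smooth_\<gamma>)
  have a: "smooth_on D (\<lambda>z. - 1 / \<omega> z)"
    by (intro smooth_intros open_D smooth_omega omega_pos)
  have pc: "pd_snd (\<lambda>_. - 1) z = 0"
    by (cases z) (simp add: pd_snd_def)
  have 2: "snd (K_op \<rho> \<gamma> (casimir_grad \<rho> \<gamma>)) z = 0"
    unfolding casimir_grad_eq_divide K_op_apply[OF a assms] pd_divide_omega[OF g2 assms]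
      pd_divide_omega[OF smooth_on_const[OF open_D] assms] p2 pc
    using ne by (simp add: field_simps power2_eq_square)
  have "2 * fst (K_op \<rho> \<gamma> (casimir_grad \<rho> \<gamma>)) z - \<gamma> z * snd (K_op \<rho> \<gamma> (casimir_grad \<rho> \<gamma>)) z = 0"
    unfolding casimir_grad_eq_divide K_op_omega[OF a assms, symmetric]
      pd_divide_omega[OF smooth_on_const[OF open_D] assms] pc
    using ne by (simp add: field_simps power2_eq_square)
  with 2 show ?thesis by simp
qed

text \<open>Flows of every index are brought to the form \<open>K w\<close>, from which the
  conservation law for \<open>\<omega>\<close> can be read off.\<close>

lemma flux_imp_chain:
  assumes M: "M \<in> dDWW_flux D \<rho> \<gamma> n" and flow: "veq_on D (pd_fst \<rho>, pd_fst \<gamma>) M"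
  obtains w where "vsmooth_on D w" "veq_on D (pd_fst \<rho>, pd_fst \<gamma>) (K_op \<rho> \<gamma> w)"
    "n \<ge> 1 \<Longrightarrow> (w, (1, 0)) \<in> step ^^ nat (n - 1)"
    "n \<le> 0 \<Longrightarrow> (casimir_grad \<rho> \<gamma>, w) \<in> step ^^ nat (- n)"
proof (cases n "0 :: int" rule: linorder_cases)
  case greater
  then have "((pd_snd \<rho>, pd_snd \<gamma>), M) \<in> ((graph_on D J_op)\<inverse> O graph_on D (K_op \<rho> \<gamma>)) ^^ nat (n - 1)"
    using M by (auto simp: dDWW_flux_def Let_def split: if_splits)
  from flux_positive[OF this] show ?thesis
    using flow greater that by (auto simp: veq_on_def)
next
  case equal
  then have "M = (0, 0)" using M by (simp add: dDWW_flux_def)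
  \<comment> \<open>The zero flow is \<open>K\<close> applied to the Casimir gradient, with a chain
    of length zero.\<close>
  then show ?thesis
    using that[of "casimir_grad \<rho> \<gamma>"] flow K_op_casimir smooth_casimir equal by (auto simp: veq_on_def)
next
  case less
  then have "(J_op (casimir_grad \<rho> \<gamma>), M) \<in> ((graph_on D (K_op \<rho> \<gamma>))\<inverse> O graph_on D J_op) ^^ nat (- n - 1)"
    using M by (auto simp: dDWW_flux_def Let_def split: if_splits)
  from flux_negative[OF this smooth_casimir] obtain w where w: "vsmooth_on D w" "veq_on D M (J_op w)"
    "(casimir_grad \<rho> \<gamma>, w) \<in> step ^^ nat (- n - 1)" by blast
  have "vsmooth_on D (pd_fst \<rho>, pd_fst \<gamma>)"
    by (simp add: vsmooth_on_def smooth_on_pd smooth_\<rho> smooth_\<gamma>)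
  \<comment> \<open>The flow is given as \<open>J w\<close>. Solving \<open>K (a, b) = J w\<close>
    adds one link and raises the length from \<open>- n - 1\<close> to \<open>- n\<close>.\<close>
  from K_op_solvable[OF this] obtain a b where ab: "smooth_on D a" "smooth_on D b"
    "veq_on D (pd_fst \<rho>, pd_fst \<gamma>) (K_op \<rho> \<gamma> (a, b))" .
  have "(w, (a, b)) \<in> step"
    using w(1,2) ab flow by (auto simp: step_def vsmooth_on_def veq_on_def)
  note relpow_Suc_I[OF w(3) this]
  moreover have "Suc (nat (- n - 1)) = nat (- n)"
    using less by simp
  ultimately have "(casimir_grad \<rho> \<gamma>, (a, b)) \<in> step ^^ nat (- n)"
    by (simp only:)
  with ab less show ?thesis
    by (intro that[of "(a, b)"]) (simp_all add: vsmooth_on_def)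
qed

text \<open>The fields \<open>Q\<close>, \<open>P\<close> and the \<open>y\<close>-derivatives \<open>-(a + a\<^sub>x)\<^sub>y\<close>, \<open>-2 b\<^sub>y\<close>, all as functions of
  \<open>(t, x)\<close>.\<close>

definition Qx :: field2 where "Qx z = (1 - pd_snd \<omega> z / \<omega> z) / \<omega> z"
definition Px :: field2 where "Px z = - \<gamma> z / \<omega> z"
definition qx :: "vfield2 \<Rightarrow> field2" where
  "qx w z = - (pd_snd (fst w) z + pd_snd (pd_snd (fst w)) z) / \<omega> z"
definition px :: "vfield2 \<Rightarrow> field2" where
  "px w z = - 2 * pd_snd (snd w) z / \<omega> z"

lemma smooth_Qx: "smooth_on D Qx" and smooth_Px: "smooth_on D Px"
  unfolding Qx_def[abs_def] Px_def[abs_def]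
  by (intro smooth_intros open_D smooth_omega smooth_\<gamma> omega_pos; assumption)+

lemma smooth_qx: "vsmooth_on D w \<Longrightarrow> smooth_on D (qx w)"
  and smooth_px: "vsmooth_on D w \<Longrightarrow> smooth_on D (px w)"
  unfolding qx_def[abs_def] px_def[abs_def] vsmooth_on_def
  by (intro smooth_intros open_D smooth_omega omega_pos; simp)+

lemma pd_Qx:
  assumes "z \<in> D"
  shows "pd_fst Qx z = - (pd_fst \<omega> z + pd_fst (pd_snd \<omega>) z) / (\<omega> z)\<^sup>2 + 2 * pd_snd \<omega> z * pd_fst \<omega> z / \<omega> z ^ 3"
    and "pd_snd Qx z = - (pd_snd \<omega> z + pd_snd (pd_snd \<omega>) z) / (\<omega> z)\<^sup>2 + 2 * pd_snd \<omega> z * pd_snd \<omega> z / \<omega> z ^ 3"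
  using assms omega_pos[OF assms] unfolding Qx_def[abs_def]
  by (cases z; simp only:; intro pd_eqI; auto intro!: derivative_eq_intros DERIV_pd[OF open_D] smooth_omega smooth_on_pd
      simp: field_simps power2_eq_square power3_eq_cube)+

lemma pd_Px:
  assumes "z \<in> D"
  shows "pd_fst Px z = - pd_fst \<gamma> z / \<omega> z + \<gamma> z * pd_fst \<omega> z / (\<omega> z)\<^sup>2"
    and "pd_snd Px z = - pd_snd \<gamma> z / \<omega> z + \<gamma> z * pd_snd \<omega> z / (\<omega> z)\<^sup>2"
  using assms omega_pos[OF assms] unfolding Px_def[abs_def]
  by (cases z; simp only:; intro pd_eqI; auto intro!: derivative_eq_intros DERIV_pd[OF open_D] smooth_omega smooth_\<gamma>
      simp: field_simps power2_eq_square)+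

lemma pd_px:
  assumes "vsmooth_on D w" "z \<in> D"
  shows "pd_snd (px w) z = - 2 * pd_snd (pd_snd (snd w)) z / \<omega> z + 2 * pd_snd (snd w) z * pd_snd \<omega> z / (\<omega> z)\<^sup>2"
  using assms omega_pos[OF assms(2)] unfolding px_def[abs_def] vsmooth_on_def
  by (cases z; simp only:; intro pd_eqI; auto intro!: derivative_eq_intros DERIV_pd[OF open_D] smooth_omega smooth_on_pd
      simp: field_simps power2_eq_square)

text \<open>\<open>K_op_omega\<close> applied to the flow gives the conservation law of
  \<open>\<omega>\<close>, which is the compatibility condition for the existence of
  \<open>y\<close>.\<close>

lemma omega_flow:
  assumes w: "vsmooth_on D w" and flow: "veq_on D (pd_fst \<rho>, pd_fst \<gamma>) (K_op \<rho> \<gamma> w)" and z: "z \<in> D"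
  shows "pd_fst \<omega> z = pd_snd \<omega> z * fst w z + \<omega> z * pd_snd (fst w) z"
proof -
  obtain a b where ab: "w = (a, b)" "smooth_on D a"
    using w by (cases w) (auto simp: vsmooth_on_def)
  have "\<omega> z * pd_fst \<omega> z = \<omega> z * (pd_snd \<omega> z * a z + \<omega> z * pd_snd a z)"
    using flow z unfolding pd_omega[OF z] K_op_omega[OF ab(2) z, of b] by (simp add: veq_on_def ab)
  then show ?thesis
    using omega_pos[OF z] by (simp add: ab)
qed

end

subsection \<open>The reciprocal transformation\<close>

locale reciprocal = dual_fields T X t0 x0 \<rho> \<gamma> + change_of_variable T X t0 x0 y
  for T X :: "real set" and t0 x0 :: real and \<rho> \<gamma> y :: field2 +
  assumes y_x: "\<And>z. z \<in> D \<Longrightarrow> pd_snd y z = omega \<rho> \<gamma> z"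
begin

abbreviation D' :: "(real \<times> real) set" where "D' \<equiv> new_domain D y"
abbreviation Q :: field2 where "Q \<equiv> pull Qx"
abbreviation P :: field2 where "P \<equiv> pull Px"

definition qp :: "vfield2 \<Rightarrow> vfield2" where
  "qp w = (pull (qx w), pull (px w))"

lemma vsmooth_qp: "vsmooth_on D w \<Longrightarrow> vsmooth_on D' (qp w)"
  by (simp add: vsmooth_on_def[of D'] qp_def smooth_on_pull smooth_qx smooth_px)

lemma pd_snd_pull:
  "smooth_on D g \<Longrightarrow> z \<in> D \<Longrightarrow> pd_snd (pull g) (new_point z) = pd_snd g z / \<omega> z"
  by (simp add: pd_pull y_x)

text \<open>Only \<open>h = f + g\<close> and \<open>H = F + G\<close> enter, with
  \<open>H\<^sub>y = h\<close>. The first row is \<open>(H\<^sub>y + Q H)\<^sub>y\<close>, and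
  \<open>H = -\<omega> a'\<close> turns the bracket into \<open>-(a' + a'\<^sub>x)\<close>. The
  second row is \<open>q + (P H)\<^sub>y\<close> with \<open>P H = \<gamma> a'\<close>, and the
  second component of \<open>K w' = J w\<close> turns it into \<open>-2 b'\<^sub>y\<close>.\<close>

lemma step_imp_Rbar:
  assumes "(w, w') \<in> step"
  shows "(qp w, qp w') \<in> Rbar_graph D' Q P"
proof -
  obtain a b where w: "w = (a, b)" by (cases w)
  obtain a' b' where w': "w' = (a', b')" by (cases w')
  have sw: "vsmooth_on D w" and sw': "vsmooth_on D w'" and KJ: "veq_on D (K_op \<rho> \<gamma> w') (J_op w)"
    using assms by (auto simp: step_def)
  have a: "smooth_on D a" and b: "smooth_on D b" and a': "smooth_on D a'" and b': "smooth_on D b'"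
    using sw sw' by (auto simp: vsmooth_on_def w w')
  note sm = smooth_Qx smooth_Px smooth_qx[OF sw] smooth_px[OF sw] smooth_omega
  define f where "f z = Px z * qx w z" for z
  define g where "g z = Qx z * px w z - pd_snd (px w) z / \<omega> z" for z
  define H where "H z = - (\<omega> z * a' z)" for z
  have f: "smooth_on D f" and g: "smooth_on D g" and H: "smooth_on D H"
    unfolding f_def[abs_def] g_def[abs_def] H_def[abs_def]
    by (intro smooth_intros open_D sm a' omega_pos; assumption)+
  have H_x: "pd_snd H z = - (pd_snd \<omega> z * a' z + \<omega> z * pd_snd a' z)" if "z \<in> D" for z
    using that unfolding H_def[abs_def]
    by (cases z; simp only:; intro pd_eqI; auto intro!: derivative_eq_intros DERIV_pd[OF open_D] a' smooth_omega)
  \<comment> \<open>Both sides equal \<open>-1/\<omega>\<close> times twice the first minus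
    \<open>\<gamma>\<close> times the second component of \<open>K w' = J w\<close>.\<close>
  have key: "pd_snd H z = \<omega> z * (f z + g z)" if z: "z \<in> D" for z
  proof -
    note ne = omega_pos(2)[OF z]
    have KJ1: "fst (K_op \<rho> \<gamma> (a', b')) z = pd_snd b z - pd_snd (pd_snd b) z"
      and KJ2: "snd (K_op \<rho> \<gamma> (a', b')) z = pd_snd a z + pd_snd (pd_snd a) z"
      using KJ z by (auto simp: veq_on_def w w' J_op_def)
    have "\<omega> z * (f z + g z) = - (2 * (pd_snd b z - pd_snd (pd_snd b) z)
        - \<gamma> z * (pd_snd a z + pd_snd (pd_snd a) z)) / \<omega> z"
      unfolding f_def g_def pd_px[OF sw z] Px_def Qx_def qx_def px_def using ne
      by (simp add: w field_simps power2_eq_square)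
    also have "\<dots> = - (pd_snd \<omega> z * a' z + \<omega> z * pd_snd a' z)"
      using ne K_op_omega[OF a' z, of b'] unfolding KJ1 KJ2 by (simp add: field_simps)
    finally show ?thesis
      using H_x[OF z] by simp
  qed
  \<comment> \<open>Any antiderivative would do for \<open>F\<close>. \<open>G\<close> takes up the
    rest of \<open>H\<close>, so that the two integration constants together match the one contained
    in \<open>a'\<close>.\<close>
  define F where "F = antideriv (\<lambda>z. \<omega> z * f z)"
  have wf: "smooth_on D (\<lambda>z. \<omega> z * f z)"
    by (intro smooth_intros open_D f smooth_omega)
  have F: "smooth_on D F" and F_x: "\<And>z. z \<in> D \<Longrightarrow> pd_snd F z = \<omega> z * f z"
    unfolding F_def using smooth_on_antideriv[OF wf] pd_antideriv(1)[OF wf] by auto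
  define G where "G z = H z - F z" for z
  have G: "smooth_on D G"
    unfolding G_def[abs_def] by (intro smooth_intros open_D F H)
  have G_x: "pd_snd G z = \<omega> z * g z" if "z \<in> D" for z
  proof -
    have "pd_snd G z = pd_snd H z - pd_snd F z"
      using that unfolding G_def[abs_def]
      by (cases z; simp only:; intro pd_eqI; auto intro!: derivative_eq_intros DERIV_pd[OF open_D] F H)
    then show ?thesis
      using key[OF that] F_x[OF that] by (simp add: algebra_simps)
  qed
  let ?f = "P * pull (qx w)" and ?g = "Q * pull (px w) - pd_snd (pull (px w))"
  have pf: "?f = pull f"
    by (simp add: fun_eq_iff pull_def f_def)
  \<comment> \<open>Unlike \<open>pf\<close>, this identity involves a \<open>y\<close>-derivative
    and is proved on \<open>D'\<close> only; differentiating it uses that \<open>D'\<close> is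
    open.\<close>
  have pg: "?g u = pull g u" if "u \<in> D'" for u
    using that by (auto simp: new_domain_eq g_def pd_snd_pull sm)
  have pg_x: "pd_snd ?g u = pd_snd (pull g) u" if "u \<in> D'" for u
    by (rule pd_cong(2)[OF open_new_domain that pg])
  have 1: "pull (qx w') u = (X_op Q ?f (pull F) + X_op Q ?g (pull G)) u"
    and 2: "pull (px w') u = (Y_op P (pull (qx w)) (pull F) + (P * ?g + pd_snd P * pull G)) u"
    if u: "u \<in> D'" for u
  proof -
    obtain z where z: "z \<in> D" and uz: "u = new_point z"
      using u by (auto simp: new_domain_eq)
    note ne = omega_pos(2)[OF z]
    have h_x: "pd_snd f z + pd_snd g z = (pd_snd (pd_snd H) z * \<omega> z - pd_snd H z * pd_snd \<omega> z) / (\<omega> z)\<^sup>2"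
    proof -
      have "pd_snd f z + pd_snd g z = pd_snd (\<lambda>z. f z + g z) z"
        using z by (cases z; simp only:; intro pd_eqI[symmetric];
          auto intro!: derivative_eq_intros DERIV_pd[OF open_D] f g)
      also have "\<dots> = pd_snd (\<lambda>z. pd_snd H z / \<omega> z) z"
        by (rule pd_cong(2)[OF open_D z]) (simp add: key omega_pos)
      finally show ?thesis
        by (simp add: pd_divide_omega[OF smooth_on_pd(2)[OF H] z])
    qed
    have H_xx: "pd_snd (pd_snd H) z
        = - (pd_snd (pd_snd \<omega>) z * a' z + 2 * pd_snd \<omega> z * pd_snd a' z + \<omega> z * pd_snd (pd_snd a') z)"
    proof -
      have "pd_snd (pd_snd H) z = pd_snd (\<lambda>z. - (pd_snd \<omega> z * a' z + \<omega> z * pd_snd a' z)) z"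
        by (rule pd_cong(2)[OF open_D z H_x])
      also have "\<dots> = - (pd_snd (pd_snd \<omega>) z * a' z + 2 * pd_snd \<omega> z * pd_snd a' z + \<omega> z * pd_snd (pd_snd a') z)"
        using z by (cases z; simp only:; intro pd_eqI;
          auto intro!: derivative_eq_intros DERIV_pd[OF open_D] a' smooth_omega smooth_on_pd)
      finally show ?thesis .
    qed
    have fg: "f z + g z = pd_snd H z / \<omega> z"
      using key[OF z] ne by simp
    have FG: "F z + G z = H z"
      by (simp add: G_def)
    have "(X_op Q ?f (pull F) + X_op Q ?g (pull G)) u
        = pd_snd (pull f) u + Q u * pull f u + pd_snd Q u * pull F u
          + (pd_snd (pull g) u + Q u * pull g u + pd_snd Q u * pull G u)"
      unfolding X_op_def pf plus_fun_apply times_fun_apply pg_x[OF u] pg[OF u] ..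
    also have "\<dots> = (pd_snd f z + pd_snd g z) / \<omega> z + Qx z * (f z + g z) + pd_snd Qx z / \<omega> z * (F z + G z)"
      by (simp add: uz z pd_snd_pull f g smooth_Qx algebra_simps add_divide_distrib)
    also have "\<dots> = qx w' z"
      unfolding h_x fg FG H_xx H_x[OF z] pd_Qx[OF z] using ne
      by (simp add: H_def Qx_def qx_def w' field_simps power2_eq_square power3_eq_cube)
    finally show "pull (qx w') u = (X_op Q ?f (pull F) + X_op Q ?g (pull G)) u"
      by (simp add: uz z)
    have KJ2: "pd_snd \<gamma> z * a' z + \<gamma> z * pd_snd a' z + 2 * pd_snd b' z = pd_snd a z + pd_snd (pd_snd a) z"
      using KJ z K_op_apply(2)[OF a' z, of b'] by (auto simp: veq_on_def w w' J_op_def)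
    have "(Y_op P (pull (qx w)) (pull F) + (P * ?g + pd_snd P * pull G)) u
        = pull (qx w) u + P u * P u * pull (qx w) u + pd_snd P u * pull F u
          + (P u * pull g u + pd_snd P u * pull G u)"
      unfolding Y_op_def plus_fun_apply times_fun_apply pg[OF u] ..
    also have "\<dots> = qx w z + Px z * (f z + g z) + pd_snd Px z / \<omega> z * (F z + G z)"
      by (simp add: uz z pd_snd_pull smooth_Px f_def algebra_simps add_divide_distrib)
    also have "\<dots> = (- (pd_snd a z + pd_snd (pd_snd a) z) + (pd_snd \<gamma> z * a' z + \<gamma> z * pd_snd a' z)) / \<omega> z"
      unfolding fg FG H_x[OF z] pd_Px[OF z] using ne
      by (simp add: H_def Px_def qx_def w field_simps power2_eq_square)
    also have "\<dots> = px w' z"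
      unfolding KJ2[symmetric] by (simp add: px_def w')
    finally show "pull (px w') u = (Y_op P (pull (qx w)) (pull F) + (P * ?g + pd_snd P * pull G)) u"
      by (simp add: uz z)
  qed
  have FG: "pd_snd (pull F) u = ?f u \<and> pd_snd (pull G) u = ?g u" if u: "u \<in> D'" for u
  proof -
    obtain z where z: "z \<in> D" and uz: "u = new_point z"
      using u by (auto simp: new_domain_eq)
    show ?thesis
      unfolding pf pg[OF u] using z omega_pos(2)[OF z] by (simp add: uz pd_snd_pull F G F_x G_x)
  qed
  have v: "veq_on D' (pull (qx w'), pull (px w')) (X_op Q ?f (pull F) + X_op Q ?g (pull G),
      Y_op P (pull (qx w)) (pull F) + (P * ?g + pd_snd P * pull G))"
    using 1 2 unfolding veq_on_def fst_conv snd_conv by blast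
  show ?thesis
    unfolding Rbar_graph_def Let_def qp_def mem_Collect_eq prod.case
    by (intro conjI exI[of _ "pull F"] exI[of _ "pull G"] ballI v
        vsmooth_qp[OF sw, unfolded qp_def] vsmooth_qp[OF sw', unfolded qp_def]
        smooth_on_pull F G FG[THEN conjunct1] FG[THEN conjunct2])
qed

section \<open>Whole chains, the flow and the two ends of a chain\<close>

lemma step_relpow_imp_Rbar:
  "(w, w') \<in> step ^^ k \<Longrightarrow> (qp w, qp w') \<in> Rbar_graph D' Q P ^^ k"
proof (induction k arbitrary: w')
  case (Suc k)
  then obtain v where "(w, v) \<in> step ^^ k" "(v, w') \<in> step"
    by auto
  with Suc.IH step_imp_Rbar show ?case
    by (meson relpow_Suc_I)
qed simp

text \<open>As \<open>y\<^sub>t = \<omega> a\<close> and \<open>y\<^sub>x = \<omega>\<close>, the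
  \<open>\<tau>\<close>-derivative is the \<open>t\<close>-derivative minus \<open>a\<close> times
  the \<open>x\<close>-derivative. The rest follows from the time derivatives of
  \<open>\<omega>\<close>, \<open>\<omega>\<^sub>x\<close> and \<open>\<gamma>\<close>.\<close>

lemma flow_eq_qp:
  assumes w: "vsmooth_on D w" and flow: "veq_on D (pd_fst \<rho>, pd_fst \<gamma>) (K_op \<rho> \<gamma> w)"
    and y_t: "\<And>z. z \<in> D \<Longrightarrow> pd_fst y z = \<omega> z * fst w z"
  shows "veq_on D' (pd_fst Q, pd_fst P) (qp w)"
proof -
  obtain a b where ab: "w = (a, b)" by (cases w)
  have a: "smooth_on D a" and b: "smooth_on D b"
    using w by (auto simp: vsmooth_on_def ab)
  have "pd_fst Q u = pull (qx w) u \<and> pd_fst P u = pull (px w) u" if "u \<in> D'" for u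
  proof -
    obtain z where z: "z \<in> D" and u: "u = new_point z"
      using \<open>u \<in> D'\<close> by (auto simp: new_domain_eq)
    note ne = omega_pos(2)[OF z]
    have omega_t: "pd_fst \<omega> z = pd_snd \<omega> z * a z + \<omega> z * pd_snd a z" if "z \<in> D" for z
      using omega_flow[OF w flow that] by (simp add: ab)
    \<comment> \<open>Symmetry of mixed derivatives lets the conservation law be differentiated in
      \<open>x\<close>.\<close>
    have "pd_fst (pd_snd \<omega>) z = pd_snd (\<lambda>z. pd_snd \<omega> z * a z + \<omega> z * pd_snd a z) z"
      unfolding pd_commute[OF smooth_omega z] by (rule pd_cong(2)[OF open_D z omega_t])
    also have "\<dots> = pd_snd (pd_snd \<omega>) z * a z + 2 * pd_snd \<omega> z * pd_snd a z + \<omega> z * pd_snd (pd_snd a) z"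
      using z by (cases z; simp only:; intro pd_eqI;
        auto intro!: derivative_eq_intros DERIV_pd[OF open_D] a smooth_omega smooth_on_pd)
    finally have omega_xt: "pd_fst (pd_snd \<omega>) z = \<dots>" .
    have gamma_t: "pd_fst \<gamma> z = pd_snd \<gamma> z * a z + \<gamma> z * pd_snd a z + 2 * pd_snd b z"
      using flow z K_op_apply(2)[OF a z, of b] by (simp add: veq_on_def ab)
    have "pd_fst Q u = pd_fst Qx z - a z * pd_snd Qx z"
      using ne by (simp add: u pd_pull[OF smooth_Qx z] y_t[OF z] y_x[OF z] ab)
    also have "\<dots> = qx w z"
      unfolding pd_Qx[OF z] omega_xt omega_t[OF z] using ne
      by (simp add: qx_def ab field_simps power2_eq_square power3_eq_cube)
    finally have Q_t: "pd_fst Q u = pull (qx w) u"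
      by (simp add: u z)
    have "pd_fst P u = pd_fst Px z - a z * pd_snd Px z"
      using ne by (simp add: u pd_pull[OF smooth_Px z] y_t[OF z] y_x[OF z] ab)
    also have "\<dots> = px w z"
      unfolding pd_Px[OF z] gamma_t omega_t[OF z] using ne
      by (simp add: px_def ab field_simps power2_eq_square)
    finally have "pd_fst P u = pull (px w) u"
      by (simp add: u z)
    with Q_t show ?thesis ..
  qed
  then show ?thesis
    by (simp add: veq_on_def qp_def)
qed

text \<open>For \<open>a = -1/\<omega>\<close> and \<open>b = \<gamma>/(2\<omega>)\<close> one has
  \<open>a + a\<^sub>x = -Q\<close> and \<open>2 b = -P\<close>, so the two
  \<open>y\<close>-derivatives are \<open>Q\<^sub>y\<close> and \<open>P\<^sub>y\<close>.\<close>

lemma qp_casimir: "veq_on D' (qp (casimir_grad \<rho> \<gamma>)) (pd_snd Q, pd_snd P)"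
proof -
  have "pull (qx (casimir_grad \<rho> \<gamma>)) u = pd_snd Q u \<and> pull (px (casimir_grad \<rho> \<gamma>)) u = pd_snd P u"
    if "u \<in> D'" for u
  proof -
    obtain z where z: "z \<in> D" and u: "u = new_point z"
      using \<open>u \<in> D'\<close> by (auto simp: new_domain_eq)
    note ne = omega_pos(2)
    have s_x: "pd_snd (\<lambda>z. - 1 / \<omega> z) z = pd_snd \<omega> z / (\<omega> z)\<^sup>2" if "z \<in> D" for z
      using pd_divide_omega(2)[OF smooth_on_const[OF open_D, of "- 1"] that] that
      by (cases z) (simp add: pd_snd_def)
    have "pd_snd (pd_snd (\<lambda>z. - 1 / \<omega> z)) z = pd_snd (\<lambda>z. pd_snd \<omega> z / (\<omega> z)\<^sup>2) z"
      by (rule pd_cong(2)[OF open_D z s_x])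
    also have "\<dots> = pd_snd (pd_snd \<omega>) z / (\<omega> z)\<^sup>2 - 2 * pd_snd \<omega> z * pd_snd \<omega> z / \<omega> z ^ 3"
      using z ne[OF z] by (cases z; simp only:; intro pd_eqI;
        auto intro!: derivative_eq_intros DERIV_pd[OF open_D] smooth_omega smooth_on_pd
          simp: field_simps power2_eq_square power3_eq_cube)
    finally have "qx (casimir_grad \<rho> \<gamma>) z = pd_snd Qx z / \<omega> z"
      unfolding pd_Qx[OF z] using s_x[OF z]
      by (simp add: qx_def casimir_grad_def add_divide_distrib diff_divide_distrib)
    moreover have "px (casimir_grad \<rho> \<gamma>) z = pd_snd Px z / \<omega> z"
    proof -
      have "pd_snd (\<lambda>z. \<gamma> z / (2 * \<omega> z)) z = pd_snd \<gamma> z / (2 * \<omega> z) - \<gamma> z * pd_snd \<omega> z / (2 * (\<omega> z)\<^sup>2)"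
        using z ne[OF z] by (cases z; simp only:; intro pd_eqI;
          auto intro!: derivative_eq_intros DERIV_pd[OF open_D] smooth_omega smooth_\<gamma>
            simp: field_simps power2_eq_square)
      then show ?thesis
        unfolding pd_Px[OF z] px_def casimir_grad_def snd_conv using ne[OF z]
        by (simp add: field_simps power2_eq_square)
    qed
    ultimately show ?thesis
      by (simp add: u z pd_snd_pull smooth_Qx smooth_Px)
  qed
  then show ?thesis
    by (simp add: veq_on_def qp_def)
qed

lemma qp_one_zero: "veq_on D' (qp (1, 0)) (0, 0)"
proof -
  have "pd_snd 1 = 0" "pd_snd 0 = 0"
    by (auto simp: pd_snd_def one_fun_def zero_fun_def)
  then show ?thesis
    by (simp add: veq_on_def qp_def pull_def qx_def px_def)
qed

lemma solves_AdDWW_pull: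
  assumes w: "vsmooth_on D w" and flow: "veq_on D (pd_fst \<rho>, pd_fst \<gamma>) (K_op \<rho> \<gamma> w)"
    and y_t: "\<And>z. z \<in> D \<Longrightarrow> pd_fst y z = \<omega> z * fst w z"
    and chain_pos: "n \<ge> 1 \<Longrightarrow> (w, (1, 0)) \<in> step ^^ nat (n - 1)"
    and chain_neg: "n \<le> 0 \<Longrightarrow> (casimir_grad \<rho> \<gamma>, w) \<in> step ^^ nat (- n)"
  shows "solves_AdDWW D' (- (n - 1)) Q P"
proof -
  let ?R = "Rbar_graph D' Q P"
  have QP: "smooth_on D' Q" "smooth_on D' P"
    by (intro smooth_on_pull smooth_Qx smooth_Px)+
  have fl: "veq_on D' (pd_fst Q, pd_fst P) (qp w)"
    by (rule flow_eq_qp[OF w flow y_t])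
  \<comment> \<open>Put \<open>m = -(n - 1)\<close>. For \<open>n \<le> 0\<close> the orbit runs
    from \<open>(Q\<^sub>y, P\<^sub>y)\<close> to the flow in \<open>m - 1 = - n\<close> steps; for
    \<open>n \<ge> 2\<close> it runs from the flow to zero in \<open>- m = n - 1\<close> steps;
    \<open>n = 1\<close> is the trivial flow.\<close>
  consider "n \<le> 0" | "n = 1" | "n \<ge> 2" by linarith
  then show ?thesis
  proof cases
    case 1
    obtain N where "veq_on D' (qp w) N" "((pd_snd Q, pd_snd P), N) \<in> ?R ^^ nat (- n)"
      using Rbar_relpow_veq_left[OF open_new_domain step_relpow_imp_Rbar[OF chain_neg[OF 1]] qp_casimir] .
    then have "\<exists>N \<in> (?R ^^ nat (- n)) `` {(pd_snd Q, pd_snd P)}. veq_on D' (pd_fst Q, pd_fst P) N"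
      using fl by (intro bexI[of _ N]) (auto simp: veq_on_def)
    moreover have "- (n - 1) - 1 = - n" "- (n - 1) \<ge> 1" using 1 by auto
    ultimately show ?thesis
      using QP by (simp only: solves_AdDWW_def Let_def) simp
  next
    case 2
    then have "w = (1, 0)" using chain_pos by simp
    then have "veq_on D' (pd_fst Q, pd_fst P) (0, 0)"
      using fl qp_one_zero by (simp add: veq_on_def)
    then show ?thesis
      using QP 2 by (simp add: solves_AdDWW_def)
  next
    case 3
    have "veq_on D' (qp w) (pd_fst Q, pd_fst P)"
      using fl by (simp add: veq_on_def)
    moreover have "n \<ge> 1" using 3 by simp
    ultimately obtain N where "veq_on D' (qp (1, 0)) N" "((pd_fst Q, pd_fst P), N) \<in> ?R ^^ nat (n - 1)"
      using Rbar_relpow_veq_left[OF open_new_domain step_relpow_imp_Rbar[OF chain_pos]] by metis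
    then have "\<exists>N \<in> (?R ^^ nat (n - 1)) `` {(pd_fst Q, pd_fst P)}. veq_on D' N (0, 0)"
      using qp_one_zero by (intro bexI[of _ N]) (auto simp: veq_on_def)
    then show ?thesis
      using QP 3 by (simp add: solves_AdDWW_def Let_def)
  qed
qed

lemma transformed_pull: "transformed D \<rho> \<gamma> y Q P"
proof -
  have "pull g (t, y (t, x)) = g (t, x)" if "(t, x) \<in> D" for g t x
    using pull_new_point[OF that, of g] by (simp add: new_point_def)
  then show ?thesis
    using smooth_y y_x by (auto simp: transformed_def Let_def Qx_def Px_def)
qed

end

theorem theorem4p3:
  fixes T X :: "real set" and \<rho> \<gamma> :: field2 and n :: int
  assumes "open T" "is_interval T" "T \<noteq> {}"
    and "open X" "is_interval X" "X \<noteq> {}"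
    and "\<And>z. z \<in> T \<times> X \<Longrightarrow> 4 * \<rho> z - (\<gamma> z)\<^sup>2 > 0"
    and "solves_dDWW (T \<times> X) n \<rho> \<gamma>"
  shows "\<exists>y Q P. transformed (T \<times> X) \<rho> \<gamma> y Q P \<and>
           solves_AdDWW (new_domain (T \<times> X) y) (- (n - 1)) Q P"
proof -
  obtain t0 x0 where "t0 \<in> T" "x0 \<in> X" using assms by blast
  then interpret strip T X t0 x0
    using assms by unfold_locales auto
  obtain M where smooth: "smooth_on D \<rho>" "smooth_on D \<gamma>"
    and M: "M \<in> dDWW_flux D \<rho> \<gamma> n" "veq_on D (pd_fst \<rho>, pd_fst \<gamma>) M"
    using assms(8) by (auto simp: solves_dDWW_def D_def)
  interpret dual_fields T X t0 x0 \<rho> \<gamma>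
    using smooth assms(7) by unfold_locales (auto simp: D_def)
  obtain w where w: "vsmooth_on D w" "veq_on D (pd_fst \<rho>, pd_fst \<gamma>) (K_op \<rho> \<gamma> w)"
    and chain: "n \<ge> 1 \<Longrightarrow> (w, (1, 0)) \<in> step ^^ nat (n - 1)"
      "n \<le> 0 \<Longrightarrow> (casimir_grad \<rho> \<gamma>, w) \<in> step ^^ nat (- n)"
    using flux_imp_chain[OF M] by blast
  have a: "smooth_on D (fst w)"
    using w by (simp add: vsmooth_on_def)
  have closed: "pd_snd (\<lambda>z. \<omega> z * fst w z) z = pd_fst \<omega> z" if "z \<in> D" for z
    by (simp add: pd_times(2)[OF smooth_omega a that] omega_flow[OF w that])
  \<comment> \<open>The integration constant in \<open>y\<close> is fixed by \<open>y\<^sub>t = \<omega> a\<close>, consistently as \<open>\<omega>\<^sub>t = (\<omega> a)\<^sub>x\<close>.\<close>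
  obtain y where y: "smooth_on D y" "\<And>z. z \<in> D \<Longrightarrow> pd_fst y z = \<omega> z * fst w z"
    "\<And>z. z \<in> D \<Longrightarrow> pd_snd y z = \<omega> z"
    using potential_exists[OF smooth_on_mult[OF open_D smooth_omega a] smooth_omega closed] by blast
  interpret reciprocal T X t0 x0 \<rho> \<gamma> y
    using y omega_pos by unfold_locales simp_all
  show ?thesis
    using transformed_pull solves_AdDWW_pull[OF w y(2) chain] unfolding D_def[symmetric] by blast
qed

end
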